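(* Let $(X_k)_{k\in\mathbb{Z}}$ be a stationary sequence with values in a Polish space $E$, with law $\mathbf{P}$. Choose any version $\mathbf{P}^{x_{-\infty,0}}$ of the regular conditional probability $\mathbf{P}[\,\cdot\,|\mathcal{F}_-]$, and define the measure $\mathbf{P}^-=\mathbf{P}[X_{-\infty,0}\in\cdot\,]$. The following are equivalent. 1. $(X_k)_{k\in\mathbb{Z}}$ is absolutely regular. 2. $\|\mathbf{P}^{x_{-\infty,0}}-\mathbf{P}\|_{\mathcal{F}_{k,\infty}}\to 0$ as $k\to\infty$ for $\mathbf{P}^-$-a.e. $x_{-\infty,0}$. 3. For $\mathbf{P}^-\otimes\mathbf{P}^-$-a.e. $(x_{-\infty,0},\tilde x_{-\infty,0})$, there exists $k\ge 0$ such that $\mathbf{P}^{x_{-\infty,0}}$ and $\mathbf{P}^{\tilde x_{-\infty,0}}$ are not mutually singular on $\mathcal{F}_{k,\infty}$.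
   Context: $E$ is a Polish space with Borel $\sigma$-field $\mathcal{E}$, $\Omega=E^{\mathbb{Z}}$, $\mathcal{F}=\mathcal{E}^{\mathbb{Z}}$, $X_k(\omega)=\omega(k)$ is the coordinate process, and $\mathbf{P}$ is a stationary (shift-invariant) probability measure on $(\Omega,\mathcal{F})$. For $m<n$ (infinite values allowed), $X_{m,n}=(X_k)_{m\le k\le n}$, $\mathcal{F}_{m,n}=\sigma\{X_{m,n}\}$, and $\mathcal{F}_-=\mathcal{F}_{-\infty,0}$. The stationary sequence $(X_k)_{k\in\mathbb{Z}}$ is absolutely regular if $$\big\|\mathbf{P}[X_{-\infty,0},X_{k,\infty}\in\cdot\,]-\mathbf{P}[X_{-\infty,0}\in\cdot\,]\otimes\mathbf{P}[X_{k,\infty}\in\cdot\,]\big\|\to 0\quad\text{as }k\to\infty.$$ For probability measures $\mu,\nu$ and a $\sigma$-field $\mathcal{G}$, $\|\mu-\nu\|_{\mathcal{G}}=2\sup_{A\in\mathcal{G}}|\mu(A)-\nu(A)|$, and $\|\mu-\nu\|$ without subscript uses the full $\sigma$-field. *)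

theory Defs
  imports "HOL-Probability.Probability"
begin

text \<open>
  A Polish space \<open>E\<close> is a type of class \<^class>\<open>polish_space\<close>, and \<open>\<Omega> = E\<^sup>\<int>\<close> is the function type
  \<open>int \<Rightarrow> 'a\<close>. Paths over an index set \<open>I\<close> of times are elements of the product space over \<open>I\<close>,
  that is, functions that are \<open>undefined\<close> outside \<open>I\<close>.
\<close>

abbreviation paths :: "int set \<Rightarrow> (int \<Rightarrow> 'a::polish_space) measure" where
  "paths I \<equiv> \<Pi>\<^sub>M i\<in>I. borel"

definition coord :: "int set \<Rightarrow> (int \<Rightarrow> 'a::polish_space) \<Rightarrow> int \<Rightarrow> 'a" where
  "coord I \<omega> = restrict \<omega> I"

text \<open>
  \<open>\<F>\<^sub>m\<^sub>,\<^sub>n\<close> is \<open>gen_alg {m..n}\<close>, with \<open>{..n}\<close> or \<open>{m..}\<close> when an end is infinite. It is a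
  \<^typ>\<open>'b measure\<close> only because the library represents \<open>\<sigma>\<close>-fields that way.
\<close>

definition gen_alg :: "int set \<Rightarrow> (int \<Rightarrow> 'a::polish_space) measure" where
  "gen_alg I = vimage_algebra (space (paths UNIV)) (coord I) (paths I)"

definition shift :: "(int \<Rightarrow> 'a) \<Rightarrow> int \<Rightarrow> 'a" where
  "shift \<omega> = (\<lambda>k. \<omega> (k + 1))"

definition stationary_law :: "(int \<Rightarrow> 'a::polish_space) measure \<Rightarrow> bool" where
  "stationary_law P \<longleftrightarrow>
     P \<in> space (prob_algebra (paths UNIV)) \<and> distr P (paths UNIV) shift = P"

definition law_on :: "(int \<Rightarrow> 'a::polish_space) measure \<Rightarrow> int set \<Rightarrow> (int \<Rightarrow> 'a) measure" where
  "law_on P I = distr P (paths I) (coord I)"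

text \<open>The supremum is bounded, hence meaningful, whenever \<open>\<mu>\<close> and \<open>\<nu>\<close> are finite measures.\<close>

definition tv_norm_on :: "'b set set \<Rightarrow> 'b measure \<Rightarrow> 'b measure \<Rightarrow> real" where
  "tv_norm_on \<G> \<mu> \<nu> = 2 * (SUP A\<in>\<G>. \<bar>measure \<mu> A - measure \<nu> A\<bar>)"

definition tv_norm :: "'b measure \<Rightarrow> 'b measure \<Rightarrow> real" where
  "tv_norm \<mu> \<nu> = tv_norm_on (sets \<mu>) \<mu> \<nu>"

definition mutually_singular_on :: "'b set set \<Rightarrow> 'b measure \<Rightarrow> 'b measure \<Rightarrow> bool" where
  "mutually_singular_on \<G> \<mu> \<nu> \<longleftrightarrow>
     (\<exists>A\<in>\<G>. emeasure \<mu> A = 0 \<and> emeasure \<nu> (space \<nu> - A) = 0)"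

definition absolutely_regular :: "(int \<Rightarrow> 'a::polish_space) measure \<Rightarrow> bool" where
  "absolutely_regular P \<longleftrightarrow>
     (\<lambda>k::nat. tv_norm
        (distr P (paths {..0} \<Otimes>\<^sub>M paths {int k..}) (\<lambda>\<omega>. (coord {..0} \<omega>, coord {int k..} \<omega>)))
        (law_on P {..0} \<Otimes>\<^sub>M law_on P {int k..}))
     \<longlonglongrightarrow> 0"

text \<open>
  \<open>K\<close> is a version of the regular conditional probability \<open>P[\<cdot> | \<F>\<^sub>-]\<close>, regarded as a probability
  kernel from the space of past trajectories \<open>x\<^sub>-\<^sub>\<infinity>\<^sub>,\<^sub>0\<close> to \<open>\<Omega>\<close>.
\<close>

definition reg_cond_prob_past ::
  "(int \<Rightarrow> 'a::polish_space) measure \<Rightarrow> ((int \<Rightarrow> 'a) \<Rightarrow> (int \<Rightarrow> 'a) measure) \<Rightarrow> bool" where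
  "reg_cond_prob_past P K \<longleftrightarrow>
     K \<in> paths {..0} \<rightarrow>\<^sub>M prob_algebra (paths UNIV) \<and>
     (\<forall>A\<in>sets (paths UNIV). AE \<omega> in P.
        measure (K (coord {..0} \<omega>)) A = real_cond_exp P (gen_alg {..0}) (indicator A) \<omega>)"

end

theory Submission
  imports Defs
begin

text \<open>
  Write \<open>\<kappa> \<omega>\<close> for the conditional law given the past of \<open>\<omega>\<close>. The three properties are proved
  equivalent in the cycle regularity \<open>\<Rightarrow>\<close> convergence of the conditional laws \<open>\<Rightarrow>\<close>
  non-singularity \<open>\<Rightarrow>\<close> regularity.

  Regularity implies convergence because the joint law of past and future can be tested on a set
  whose fibre over each past \<open>x\<close> is a future event on which \<open>K x\<close> and \<open>P\<close> differ by more than \<open>e\<close>,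
  whenever there is one; the joint and the product law then differ on this set by at least \<open>e\<close> times
  the probability of such pasts. A measurable choice of the fibres is possible because the
  supremum in the total variation norm may be taken over countably many future events
  (\<open>countable_family_almost_maximal_future\<close>). Convergence implies non-singularity by the triangle
  inequality.

  The substance lies in the last implication, which is a zero-one type law. If regularity fails, a
  Hahn decomposition argument along the decreasing \<open>\<sigma>\<close>-fields generated by the past and the future
  after \<open>k\<close> (\<open>near_maximal_set_in_intersection\<close>) gives one set \<open>S\<close> of pairs (past path, path)
  that depends on the second path only through its tail and that has different probabilities under
  the joint law, where both paths are equal, and under \<open>P \<Otimes> P\<close>. Hence for independent \<open>\<omega>\<close> and \<open>\<omega>'\<close>
  there is a positive probability \<open>c\<close> that exactly one of \<open>(\<omega>, \<omega>)\<close> and \<open>(\<omega>, \<omega>')\<close> lies in \<open>S\<close>. By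
  Levy's zero-one law, someone who observes \<open>\<omega>\<close> and \<open>\<omega>'\<close> up to a late time \<open>n\<close> can predict with small
  error whether each of these pairs lies in \<open>S\<close>; so the conditional laws of the two futures given
  the observations up to time \<open>n\<close> assign probabilities close to \<open>0\<close> and \<open>1\<close>, in some order, to the
  same tail event, namely the fibre of \<open>S\<close> over \<open>\<omega>\<close>. Stationarity moves time \<open>n\<close> back to time \<open>0\<close>.
  Thus with probability at least about \<open>c\<close> the laws \<open>\<kappa> \<omega>\<close> and \<open>\<kappa> \<omega>'\<close> are almost singular, to any
  degree, on arbitrarily remote futures, and in the limit they are singular on each of them with
  positive probability, which contradicts non-singularity.

  The zero-one law is used in a quantitative form that requires no martingales: approximating \<open>S\<close> by
  a set \<open>S'\<close> that depends on finitely much of the future controls all errors by the probabilities of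
  the symmetric difference of \<open>S\<close> and \<open>S'\<close> (\<open>kernels_separated\<close>).
\<close>

section \<open>Approximation along increasing and decreasing families of set algebras\<close>

lemma sets_pair_measure_mono:
  assumes "space M = space M'" "sets M \<subseteq> sets M'" "space N = space N'" "sets N \<subseteq> sets N'"
  shows "sets (M \<Otimes>\<^sub>M N) \<subseteq> sets (M' \<Otimes>\<^sub>M N')"
proof -
  have "{a \<times> b |a b. a \<in> sets M \<and> b \<in> sets N} \<subseteq> {a \<times> b |a b. a \<in> sets M' \<and> b \<in> sets N'}"
    using assms by blast
  then show ?thesis unfolding sets_pair_measure assms(1,3) by (rule sigma_sets_mono')
qed

text \<open>
  The sets that can be approximated form a \<open>\<sigma>\<close>-field: a countable union is, up to small measure, a
  finite one, and finitely many approximants belong to a common \<open>F n\<close>. Two measures are treated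
  at once because the same approximant has to serve both.
\<close>
lemma approx_by_increasing_algebras:
  assumes "finite_measure \<mu>" "finite_measure \<nu>" and sets_eq: "sets \<nu> = sets \<mu>"
    and alg: "\<And>n. algebra (space \<mu>) (F n)" and mono: "mono (F :: nat \<Rightarrow> _)"
    and sub: "\<And>n. F n \<subseteq> sets \<mu>"
    and A: "A \<in> sigma_sets (space \<mu>) (\<Union>n. F n)" and e: "(e::real) > 0"
  shows "\<exists>n. \<exists>B\<in>F n. measure \<mu> (sym_diff A B) < e \<and> measure \<nu> (sym_diff A B) < e"
  using A e
proof (induction arbitrary: e)
  interpret \<mu>: finite_measure \<mu> by fact
  interpret \<nu>: finite_measure \<nu> by fact
  interpret F: algebra "space \<mu>" "F n" for n by (rule alg)
  have sigma_sub: "sigma_sets (space \<mu>) (\<Union>n. F n) \<subseteq> sets \<mu>"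
    using sub by (intro sets.sigma_sets_subset) auto
  {
    case (Basic A)
    then obtain n where "A \<in> F n" by blast
    with Basic.prems show ?case by (intro exI[of _ n] bexI[of _ A]) auto
  next
    case Empty
    then show ?case
      by (intro exI[of _ 0] bexI[of _ "{}"]) auto
  next
    case (Compl A)
    then obtain n B where B: "B \<in> F n" "measure \<mu> (sym_diff A B) < e" "measure \<nu> (sym_diff A B) < e"
      by meson
    have "A \<subseteq> space \<mu>" "B \<subseteq> space \<mu>"
      using Compl.hyps B(1) sigma_sub sub sets.sets_into_space by blast+
    then have "sym_diff (space \<mu> - A) (space \<mu> - B) = sym_diff A B" by blast
    then show ?case
      using B by (intro exI[of _ n] bexI[of _ "space \<mu> - B"]) auto
  next
    case (Union A)
    have A: "A i \<in> sets \<mu>" for i using Union.hyps sigma_sub by auto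
    define T where "T N = (\<Union>i. A i) - (\<Union>i<N. A i)" for N :: nat
    have T: "T N \<in> sets \<mu>" for N using A by (auto simp: T_def)
    have decT: "decseq T" unfolding T_def decseq_def by force
    have "(\<Inter>N. T N) = {}" unfolding T_def by blast
    then have "(\<lambda>N. measure \<mu> (T N)) \<longlonglongrightarrow> 0" "(\<lambda>N. measure \<nu> (T N)) \<longlonglongrightarrow> 0"
      using \<mu>.finite_Lim_measure_decseq[of T] \<nu>.finite_Lim_measure_decseq[of T] T decT sets_eq by auto
    then have "\<forall>\<^sub>F N in sequentially. measure \<mu> (T N) < e/2 \<and> measure \<nu> (T N) < e/2"
      using \<open>e > 0\<close> by (intro eventually_conj order_tendstoD) auto
    then obtain N where N: "measure \<mu> (T N) < e/2" "measure \<nu> (T N) < e/2"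
      by (auto simp: eventually_sequentially)
    \<comment> \<open>\<open>Suc N\<close> rather than \<open>N\<close>, so that the case \<open>N = 0\<close> is no exception.\<close>
    define e' where "e' = e / 2 / Suc N"
    have "e' > 0" using Union.prems by (simp add: e'_def)
    then have "\<forall>i. \<exists>n. \<exists>B\<in>F n. measure \<mu> (sym_diff (A i) B) < e' \<and> measure \<nu> (sym_diff (A i) B) < e'"
      using Union.IH by blast
    then obtain n B where nB: "\<And>i. B i \<in> F (n i)" "\<And>i. measure \<mu> (sym_diff (A i) (B i)) < e'"
        "\<And>i. measure \<nu> (sym_diff (A i) (B i)) < e'" by metis
    define m where "m = Max (n ` {..N})"
    have Bm: "B i \<in> F m" if "i < N" for i
    proof -
      have "n i \<le> m" using that unfolding m_def by (intro Max_ge) auto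
      then show ?thesis using nB(1)[of i] mono by (auto dest: monoD)
    qed
    have fin: "(\<Union>i<N. B i) \<in> F m"
      using Bm by (intro F.finite_UN) auto
    have B: "B i \<in> sets \<mu>" for i using nB(1) sub by auto
    have cover: "sym_diff (\<Union>i. A i) (\<Union>i<N. B i) \<subseteq> T N \<union> (\<Union>i<N. sym_diff (A i) (B i))"
      unfolding T_def by blast
    have bound: "measure \<rho> (sym_diff (\<Union>i. A i) (\<Union>i<N. B i)) < e"
      if \<rho>: "finite_measure \<rho>" "sets \<rho> = sets \<mu>" and TN: "measure \<rho> (T N) < e/2"
        and Bi: "\<And>i. measure \<rho> (sym_diff (A i) (B i)) < e'" for \<rho>
    proof -
      interpret \<rho>: finite_measure \<rho> by fact
      have "measure \<rho> (sym_diff (\<Union>i. A i) (\<Union>i<N. B i))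
          \<le> measure \<rho> (T N \<union> (\<Union>i<N. sym_diff (A i) (B i)))"
        using cover A B T \<rho>(2) by (intro \<rho>.finite_measure_mono) auto
      also have "\<dots> \<le> measure \<rho> (T N) + measure \<rho> (\<Union>i<N. sym_diff (A i) (B i))"
        using A B T \<rho>(2) by (intro measure_Un_le) auto
      also have "measure \<rho> (\<Union>i<N. sym_diff (A i) (B i)) \<le> (\<Sum>i<N. measure \<rho> (sym_diff (A i) (B i)))"
        using A B \<rho>(2) by (intro \<rho>.finite_measure_subadditive_finite) auto
      also have "\<dots> \<le> (\<Sum>i<N. e')" using Bi by (intro sum_mono) (simp add: less_imp_le)
      also have "\<dots> \<le> e / 2" using Union.prems by (simp add: e'_def field_simps)
      finally show ?thesis using TN by simp
    qed
    show ?case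
      using fin bound[OF \<open>finite_measure \<mu>\<close> _ N(1) nB(2)] bound[OF \<open>finite_measure \<nu>\<close> _ N(2) nB(3)] sets_eq
      by (intro exI[of _ m] bexI[of _ "\<Union>i<N. B i"]) auto
  }
qed

text \<open>
  This is the construction of the positive set in Hahn's decomposition theorem, carried out in a
  decreasing family of \<open>\<sigma>\<close>-fields. With \<open>S k \<in> G k\<close> almost maximal for \<open>\<mu> - \<nu>\<close> on \<open>G k\<close>, adjoining
  \<open>S k\<close> to a set in \<open>G k\<close> lowers the difference by no more than the error allowed for \<open>S k\<close>, since
  the difference is modular and the intersection cannot exceed the supremum over \<open>G k\<close>. With
  summable errors, \<open>limsup S k\<close> still reaches \<open>b\<close>, and it belongs to every \<open>G k\<close>. For a constant
  family the lemma says that a supremum over a \<open>\<sigma>\<close>-field is attained.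
\<close>
lemma near_maximal_set_in_intersection:
  assumes "finite_measure \<mu>" "finite_measure \<nu>" and sets_eq: "sets \<nu> = sets \<mu>"
    and alg: "\<And>k. sigma_algebra (space \<mu>) (G k)" and dec: "antimono (G :: nat \<Rightarrow> _)"
    and sub: "\<And>k. G k \<subseteq> sets \<mu>"
    and near: "\<And>k e. (e::real) > 0 \<Longrightarrow> \<exists>S\<in>G k. b - e < measure \<mu> S - measure \<nu> S"
  shows "\<exists>S\<in>(\<Inter>k. G k). b \<le> measure \<mu> S - measure \<nu> S"
proof -
  interpret \<mu>: finite_measure \<mu> by fact
  interpret \<nu>: finite_measure \<nu> by fact
  interpret G: sigma_algebra "space \<mu>" "G k" for k by (rule alg)
  define d where "d S = measure \<mu> S - measure \<nu> S" for S
  define top where "top k = (SUP S\<in>G k. d S)" for k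
  have bdd: "bdd_above (d ` G k)" for k
  proof (rule bdd_aboveI2)
    fix S assume "S \<in> G k"
    show "d S \<le> measure \<mu> (space \<mu>)"
      unfolding d_def using \<mu>.bounded_measure[of S] measure_nonneg[of \<nu> S] by linarith
  qed
  have d_le_top: "d S \<le> top k" if "S \<in> G k" for S k
    unfolding top_def using that bdd by (intro cSUP_upper)
  have b_le_top: "b \<le> top k" for k
  proof (rule field_le_epsilon)
    fix e :: real assume "e > 0"
    then show "b \<le> top k + e" using near[of e k] d_le_top[of _ k] unfolding d_def by force
  qed
  have "\<exists>S\<in>G k. top k - (1/2)^k < d S" for k
  proof -
    have "G k \<noteq> {}" by auto
    then show ?thesis using less_cSUP_iff[OF _ bdd, of k "top k - (1/2)^k"] by (simp add: top_def)
  qed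
  then obtain S where S: "\<And>k. S k \<in> G k" "\<And>k. top k - (1/2)^k < d (S k)" by metis
  have SG: "S i \<in> G k" if "k \<le> i" for i k
    using S(1)[of i] dec that by (auto dest: antimonoD)
  have SM: "S i \<in> sets \<mu>" for i using S(1) sub by auto
  have modular: "d (A \<union> B) = d A + d B - d (A \<inter> B)" if "A \<in> sets \<mu>" "B \<in> sets \<mu>" for A B
    using that by (simp add: d_def \<mu>.finite_measure_Union' \<nu>.finite_measure_Union' sets_eq
        \<mu>.finite_measure_Diff' \<nu>.finite_measure_Diff' Int_commute)
  \<comment> \<open>The error is the sum of \<open>(1/2)^i\<close> over \<open>i \<ge> k\<close>; it makes the induction on \<open>j\<close> close exactly.\<close>
  have finite_union: "b - 2 * (1/2)^k < d (\<Union>i\<in>{k..k + j}. S i)" for j k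
  proof (induction j arbitrary: k)
    case 0
    have "(0::real) < (1/2)^k" by simp
    then show ?case using S(2)[of k] b_le_top[of k] by (simp del: zero_less_power)
  next
    case (Suc j)
    define V where "V = (\<Union>i\<in>{Suc k..Suc k + j}. S i)"
    have split: "(\<Union>i\<in>{k..k + Suc j}. S i) = S k \<union> V"
    proof -
      have "{k..k + Suc j} = insert k {Suc k..Suc k + j}" by auto
      then show ?thesis by (simp add: V_def)
    qed
    have "V \<in> G k" unfolding V_def using SG by auto
    then have "S k \<inter> V \<in> G k" "V \<in> sets \<mu>" using S(1) sub by auto
    then have "d (S k \<union> V) \<ge> d (S k) + d V - top k"
      using modular[of "S k" V] SM d_le_top[of "S k \<inter> V" k] by simp
    then show ?case using Suc.IH[of "Suc k"] S(2)[of k] unfolding split V_def by simp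
  qed
  define W where "W k = (\<Union>i\<in>{k..}. S i)" for k
  have W: "W k \<in> sets \<mu>" for k using SM by (auto simp: W_def)
  have WG: "W i \<in> G k" if "k \<le> i" for i k
    unfolding W_def using SG that by (intro G.countable_UN'') auto
  have dW: "b - 2 * (1/2)^k \<le> d (W k)" for k
  proof -
    have inc: "incseq (\<lambda>j. \<Union>i\<in>{k..k + j}. S i)" by (force simp: incseq_def)
    have un: "(\<Union>j. \<Union>i\<in>{k..k + j}. S i) = W k"
    proof -
      have "x \<in> (\<Union>j. \<Union>i\<in>{k..k + j}. S i)" if "x \<in> S i" "k \<le> i" for x i
        using that by (auto intro!: exI[of _ i])
      then show ?thesis by (auto simp: W_def)
    qed
    have "(\<lambda>j. d (\<Union>i\<in>{k..k + j}. S i)) \<longlonglongrightarrow> d (W k)"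
      unfolding d_def un[symmetric] using inc SM sets_eq
      by (intro tendsto_diff \<mu>.finite_Lim_measure_incseq \<nu>.finite_Lim_measure_incseq) auto
    then show ?thesis
      by (rule tendsto_lowerbound) (auto intro!: always_eventually less_imp_le[OF finite_union])
  qed
  have decW: "decseq W" by (force simp: W_def decseq_def)
  have "(\<lambda>k. d (W k)) \<longlonglongrightarrow> d (\<Inter>k. W k)"
    unfolding d_def using decW W sets_eq
    by (intro tendsto_diff \<mu>.finite_Lim_measure_decseq \<nu>.finite_Lim_measure_decseq) auto
  moreover have "(\<lambda>k. b - 2 * (1/2)^k) \<longlonglongrightarrow> b - 2 * 0"
    by (intro tendsto_intros LIMSEQ_realpow_zero) auto
  ultimately have "b \<le> d (\<Inter>k. W k)"
    using dW LIMSEQ_le[of "\<lambda>k. b - 2 * (1/2)^k" "b - 2*0" "\<lambda>k. d (W k)"] by auto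
  moreover have "(\<Inter>k. W k) \<in> G m" for m
  proof -
    have "(\<Inter>k. W k) = (\<Inter>k\<in>{m..}. W k)"
    proof (intro equalityI subsetI INT_I)
      fix x k assume "x \<in> (\<Inter>k\<in>{m..}. W k)"
      then have "x \<in> W (max k m)" by simp
      then show "x \<in> W k" using decseqD[OF decW, of k "max k m"] by auto
    qed auto
    also have "\<dots> \<in> G m" using WG by (intro G.countable_INT') auto
    finally show ?thesis .
  qed
  ultimately show ?thesis unfolding d_def by blast
qed

section \<open>The \<open>\<sigma>\<close>-fields generated by sets of coordinates\<close>

lemma space_gen_alg [simp]: "space (gen_alg I) = UNIV"
  by (simp add: gen_alg_def space_PiM)

lemma coord_measurable [measurable]: "coord I \<in> paths UNIV \<rightarrow>\<^sub>M paths I"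
  unfolding coord_def by measurable

lemma sets_gen_alg: "sets (gen_alg I) = {coord I -` A |A. A \<in> sets (paths I)}"
  unfolding gen_alg_def
  by (subst sets_vimage_algebra2) (auto simp: coord_def space_PiM)

lemma coord_measurable_gen_alg [measurable]: "coord I \<in> gen_alg I \<rightarrow>\<^sub>M paths I"
  unfolding gen_alg_def by (intro measurable_vimage_algebra1) (auto simp: coord_def space_PiM)

lemma measurable_into_gen_alg:
  assumes "(\<lambda>x. coord I (f x)) \<in> N \<rightarrow>\<^sub>M paths I"
  shows "f \<in> N \<rightarrow>\<^sub>M gen_alg I"
  unfolding gen_alg_def by (intro measurable_vimage_algebra2 assms) (auto simp: space_PiM)

lemma measurable_coordinate_gen_alg:
  assumes "i \<in> I"
  shows "(\<lambda>\<omega>. \<omega> i) \<in> gen_alg I \<rightarrow>\<^sub>M borel"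
proof -
  have "(\<lambda>\<omega>. coord I \<omega> i) \<in> gen_alg I \<rightarrow>\<^sub>M borel"
    by (rule measurable_compose[OF coord_measurable_gen_alg]) (use assms in measurable)
  then show ?thesis using assms by (simp add: coord_def)
qed

lemma measurable_gen_algI:
  assumes "\<And>i. i \<in> I \<Longrightarrow> (\<lambda>x. f x i) \<in> N \<rightarrow>\<^sub>M borel"
  shows "f \<in> N \<rightarrow>\<^sub>M gen_alg I"
  by (intro measurable_into_gen_alg) (auto simp: coord_def intro!: measurable_restrict assms)

lemma gen_alg_mono:
  assumes "I \<subseteq> L"
  shows "sets (gen_alg I) \<subseteq> sets (gen_alg L)"
proof
  fix A :: "(int \<Rightarrow> 'a) set" assume A: "A \<in> sets (gen_alg I)"
  have "(\<lambda>\<omega>. \<omega>) \<in> gen_alg L \<rightarrow>\<^sub>M (gen_alg I :: (int \<Rightarrow> 'a) measure)"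
    using assms by (intro measurable_gen_algI measurable_coordinate_gen_alg) auto
  from measurable_sets[OF this A] show "A \<in> sets (gen_alg L)" by simp
qed

lemma sets_gen_alg_UNIV: "sets (gen_alg UNIV) = sets (paths UNIV)"
proof -
  have "coord UNIV = (\<lambda>\<omega> :: int \<Rightarrow> 'a. \<omega>)" by (intro ext) (simp add: coord_def)
  then show ?thesis by (simp add: sets_gen_alg)
qed

lemma gen_alg_subset: "sets (gen_alg I) \<subseteq> sets (paths UNIV)"
  using gen_alg_mono[of I UNIV] sets_gen_alg_UNIV by auto

lemma measurable_from_gen_alg:
  assumes "f \<in> gen_alg I \<rightarrow>\<^sub>M N"
  shows "f \<in> paths UNIV \<rightarrow>\<^sub>M N"
  using assms gen_alg_subset[of I] by (auto simp: measurable_def space_PiM)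

lemma sets_pair_gen_alg_mono:
  assumes "I \<subseteq> I'" "L \<subseteq> L'"
  shows "sets (gen_alg I \<Otimes>\<^sub>M gen_alg L) \<subseteq> sets (gen_alg I' \<Otimes>\<^sub>M gen_alg L')"
  using assms by (intro sets_pair_measure_mono gen_alg_mono) simp_all

section \<open>Countable families that determine the total variation norm\<close>

lemma countable_unions_approximate_open:
  obtains U :: "nat \<Rightarrow> 'b::second_countable_topology set"
  where "\<And>i. open (U i)"
    and "\<And>V. open V \<Longrightarrow> \<exists>s. incseq (\<lambda>n. U (s n)) \<and> (\<Union>n. U (s n)) = V"
proof -
  obtain B :: "'b set set" where B: "countable B" "topological_basis B"
    using ex_countable_basis by blast
  define \<U> where "\<U> = Union ` {F. finite F \<and> F \<subseteq> B}"
  have "countable {F. finite F \<and> F \<subseteq> B}"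
    using countable_Collect_finite_subset[OF B(1)] by (simp add: conj_commute)
  then have cU: "countable \<U>" unfolding \<U>_def by blast
  have ne: "{} \<in> \<U>" unfolding \<U>_def by (rule image_eqI[of _ _ "{}"]) auto
  have range: "range (from_nat_into \<U>) = \<U>"
    using cU ne by (intro range_from_nat_into) auto
  show thesis
  proof
    fix i
    have "from_nat_into \<U> i \<in> \<U>" using ne by (intro from_nat_into) auto
    then show "open (from_nat_into \<U> i)"
      using topological_basis_open[OF B(2)] unfolding \<U>_def by (elim imageE) (simp add: subset_eq open_Union)
  next
    fix V :: "'b set" assume "open V"
    then obtain B' where B': "B' \<subseteq> B" "\<Union>B' = V"
      using B(2) unfolding topological_basis_def by metis
    define b where "b = from_nat_into (insert {} B')"
    have rb: "range b = insert {} B'"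
      unfolding b_def using B'(1) B(1) by (intro range_from_nat_into) (auto intro: countable_subset)
    have "\<exists>j. from_nat_into \<U> j = (\<Union>i<n. b i)" for n
    proof -
      have "(\<Union>i<n. b i) = \<Union>(b ` {..<n} - {{}})" by auto
      moreover have "b ` {..<n} - {{}} \<subseteq> B" using rb B'(1) by blast
      ultimately have "(\<Union>i<n. b i) \<in> \<U>" unfolding \<U>_def by blast
      then show ?thesis using range by (metis imageE)
    qed
    then obtain s where s: "\<And>n. from_nat_into \<U> (s n) = (\<Union>i<n. b i)" by metis
    have "(\<Union>n. \<Union>i<n. b i) = \<Union>(range b)" by blast
    also have "\<dots> = V" using rb B'(2) by auto
    finally have "(\<Union>n. \<Union>i<n. b i) = V" .
    moreover have "incseq (\<lambda>n. \<Union>i<n. b i)" by (force simp: incseq_def)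
    ultimately show "\<exists>s. incseq (\<lambda>n. from_nat_into \<U> (s n)) \<and> (\<Union>n. from_nat_into \<U> (s n)) = V"
      using s by (intro exI[of _ s]) simp
  qed
qed

text \<open>
  Replacing \<open>A\<close> by a larger open set can only increase \<open>\<mu> A\<close>, and by outer regularity of \<open>\<nu>\<close> it can be
  chosen to increase \<open>\<nu> A\<close> very little. The open set is in turn an increasing limit of finite unions of
  basic open sets, of which there are countably many. The family does not depend on the measures,
  which allows measurable choices when the measures vary.
\<close>
lemma countable_family_almost_maximal_borel:
  obtains U :: "nat \<Rightarrow> 'b::polish_space set"
  where "\<And>i. U i \<in> sets borel"
    and "\<And>\<mu> \<nu> A e. \<lbrakk>finite_measure \<mu>; finite_measure \<nu>; sets \<mu> = sets borel; sets \<nu> = sets borel;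
      A \<in> sets borel; (e::real) > 0\<rbrakk>
      \<Longrightarrow> \<exists>i. measure \<mu> A - measure \<nu> A - e < measure \<mu> (U i) - measure \<nu> (U i)"
proof -
  obtain U :: "nat \<Rightarrow> 'b set" where U: "\<And>i. open (U i)"
    "\<And>V. open V \<Longrightarrow> \<exists>s. incseq (\<lambda>n. U (s n)) \<and> (\<Union>n. U (s n)) = V"
    using countable_unions_approximate_open by blast
  show thesis
  proof
    show "U i \<in> sets borel" for i using U(1) by simp
  next
    fix \<mu> \<nu> :: "'b measure" and A :: "'b set" and e
    assume fin: "finite_measure \<mu>" "finite_measure \<nu>" and sets: "sets \<mu> = sets borel" "sets \<nu> = sets borel"
      and A: "A \<in> sets borel" and e: "(e::real) > 0"
    interpret \<mu>: finite_measure \<mu> by fact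
    interpret \<nu>: finite_measure \<nu> by fact
    have outer: "emeasure \<nu> A = (INF V\<in>{V. A \<subseteq> V \<and> open V}. emeasure \<nu> V)"
      using sets A \<nu>.emeasure_finite by (intro outer_regular) auto
    then have "(INF V\<in>{V. A \<subseteq> V \<and> open V}. emeasure \<nu> V) < ennreal (measure \<nu> A + e)"
      unfolding outer[symmetric] using e by (simp add: \<nu>.emeasure_eq_measure ennreal_less_iff)
    then obtain V where V: "A \<subseteq> V" "open V" "emeasure \<nu> V < ennreal (measure \<nu> A + e)"
      by (auto simp: INF_less_iff)
    then have "measure \<nu> V < measure \<nu> A + e"
      by (simp add: \<nu>.emeasure_eq_measure ennreal_less_iff)
    moreover have "measure \<mu> A \<le> measure \<mu> V"
      using V sets by (intro \<mu>.finite_measure_mono) auto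
    ultimately have V_near: "measure \<mu> A - measure \<nu> A - e < measure \<mu> V - measure \<nu> V" by simp
    obtain s where s: "incseq (\<lambda>n. U (s n))" "(\<Union>n. U (s n)) = V" using U(2)[OF V(2)] by blast
    have "(\<lambda>n. measure \<mu> (U (s n)) - measure \<nu> (U (s n))) \<longlonglongrightarrow> measure \<mu> V - measure \<nu> V"
      unfolding s(2)[symmetric] using s(1) U(1) sets
      by (intro tendsto_diff \<mu>.finite_Lim_measure_incseq \<nu>.finite_Lim_measure_incseq) auto
    from order_tendstoD(1)[OF this V_near]
    show "\<exists>i. measure \<mu> A - measure \<nu> A - e < measure \<mu> (U i) - measure \<nu> (U i)"
      by (auto simp: eventually_sequentially)
  qed
qed

text \<open>
  The map that replaces the values of a path before time \<open>k\<close> by its value at \<open>k\<close> leaves all events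
  of the future after \<open>k\<close> invariant, and it pulls every Borel set back to such an event. Hence the
  Borel result can be applied to the images of the two measures under this map.
\<close>
lemma countable_family_almost_maximal_future:
  obtains C :: "nat \<Rightarrow> (int \<Rightarrow> 'a::polish_space) set"
  where "\<And>i. C i \<in> sets (gen_alg {k..})"
    and "\<And>\<mu> \<nu> A e. \<lbrakk>finite_measure \<mu>; finite_measure \<nu>; sets \<mu> = sets (paths UNIV);
      sets \<nu> = sets (paths UNIV); A \<in> sets (gen_alg {k..}); (e::real) > 0\<rbrakk>
      \<Longrightarrow> \<exists>i. measure \<mu> A - measure \<nu> A - e < measure \<mu> (C i) - measure \<nu> (C i)"
proof -
  obtain U :: "nat \<Rightarrow> (int \<Rightarrow> 'a) set" where U: "\<And>i. U i \<in> sets borel"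
    "\<And>\<mu> \<nu> A e. \<lbrakk>finite_measure \<mu>; finite_measure \<nu>; sets \<mu> = sets borel; sets \<nu> = sets borel;
      A \<in> sets borel; (e::real) > 0\<rbrakk>
      \<Longrightarrow> \<exists>i. measure \<mu> A - measure \<nu> A - e < measure \<mu> (U i) - measure \<nu> (U i)"
    using countable_family_almost_maximal_borel by blast
  define \<phi> :: "(int \<Rightarrow> 'a) \<Rightarrow> int \<Rightarrow> 'a" where "\<phi> \<omega> = (\<lambda>i. \<omega> (max i k))" for \<omega>
  have \<phi>: "\<phi> \<in> gen_alg {k..} \<rightarrow>\<^sub>M borel"
  proof -
    have "\<phi> \<in> gen_alg {k..} \<rightarrow>\<^sub>M paths UNIV"
      unfolding \<phi>_def by (intro measurable_PiM_single') (auto simp: space_PiM intro!: measurable_coordinate_gen_alg)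
    then show ?thesis by (simp cong: measurable_cong_sets add: sets_PiM_equal_borel)
  qed
  have \<phi>_fixes: "\<phi> -` A = A" if A: "A \<in> sets (gen_alg {k..})" for A
  proof -
    have "coord {k..} (\<phi> \<omega>) = coord {k..} \<omega>" for \<omega>
      by (auto simp: coord_def \<phi>_def restrict_def max_def)
    then show ?thesis using A unfolding sets_gen_alg by auto
  qed
  show thesis
  proof
    show "\<phi> -` U i \<in> sets (gen_alg {k..})" for i
      using measurable_sets[OF \<phi> U(1)] by simp
  next
    fix \<mu> \<nu> :: "(int \<Rightarrow> 'a) measure" and A :: "(int \<Rightarrow> 'a) set" and e
    assume fin: "finite_measure \<mu>" "finite_measure \<nu>"
      and sets: "sets \<mu> = sets (paths UNIV)" "sets \<nu> = sets (paths UNIV)"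
      and A: "A \<in> sets (gen_alg {k..})" and e: "(e::real) > 0"
    have space: "space \<mu> = UNIV" "space \<nu> = UNIV"
      using sets_eq_imp_space_eq[OF sets(1)] sets_eq_imp_space_eq[OF sets(2)] by (auto simp: space_PiM)
    have \<phi>_meas: "\<phi> \<in> \<mu> \<rightarrow>\<^sub>M borel" "\<phi> \<in> \<nu> \<rightarrow>\<^sub>M borel"
      using measurable_from_gen_alg[OF \<phi>] sets by (simp_all cong: measurable_cong_sets)
    have A': "A \<in> sets borel"
      using A gen_alg_subset[of "{k..}"] by (auto simp: sets_PiM_equal_borel)
    have "\<exists>i. measure (distr \<mu> borel \<phi>) A - measure (distr \<nu> borel \<phi>) A - e
        < measure (distr \<mu> borel \<phi>) (U i) - measure (distr \<nu> borel \<phi>) (U i)"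
      using fin \<phi>_meas A' e by (intro U(2) finite_measure.finite_measure_distr) auto
    then show "\<exists>i. measure \<mu> A - measure \<nu> A - e < measure \<mu> (\<phi> -` U i) - measure \<nu> (\<phi> -` U i)"
      using \<phi>_meas U(1) A' by (simp add: measure_distr space \<phi>_fixes[OF A])
  qed
qed

section \<open>Prediction of an event by a regular conditional probability\<close>

locale regular_conditional_kernel = prob_space P for P :: "'b measure" +
  fixes F :: "'b measure" and \<kappa> :: "'b \<Rightarrow> 'b measure"
  assumes subalg: "subalgebra P F"
    and kernel [measurable]: "\<kappa> \<in> F \<rightarrow>\<^sub>M prob_algebra P"
    and integral_kernel: "\<And>A C. A \<in> sets P \<Longrightarrow> C \<in> sets F \<Longrightarrow>
      (\<integral>\<omega>\<in>C. measure (\<kappa> \<omega>) A \<partial>P) = prob (C \<inter> A)"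
begin

lemma space_F: "space F = space P" and sets_F: "sets F \<subseteq> sets P"
  using subalg by (auto simp: subalgebra_def)

lemma measurable_from_F: "f \<in> F \<rightarrow>\<^sub>M N \<Longrightarrow> f \<in> P \<rightarrow>\<^sub>M N"
  using sets_F by (auto simp: measurable_def space_F)

lemma kernel_P [measurable]: "\<kappa> \<in> P \<rightarrow>\<^sub>M prob_algebra P"
  by (rule measurable_from_F[OF kernel])

lemma prob_space_kernel: "\<omega> \<in> space P \<Longrightarrow> prob_space (\<kappa> \<omega>)"
  and sets_kernel: "\<omega> \<in> space P \<Longrightarrow> sets (\<kappa> \<omega>) = sets P"
  and space_kernel: "\<omega> \<in> space P \<Longrightarrow> space (\<kappa> \<omega>) = space P"
  using measurable_space[OF kernel_P, of \<omega>] by (auto simp: space_prob_algebra dest: sets_eq_imp_space_eq)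

lemma sets_FP: "sets (F \<Otimes>\<^sub>M P) \<subseteq> sets (P \<Otimes>\<^sub>M P)"
  using sets_F by (intro sets_pair_measure_mono) (auto simp: space_F)

lemma sets_FF: "sets (F \<Otimes>\<^sub>M F) \<subseteq> sets (F \<Otimes>\<^sub>M P)"
  using sets_F by (intro sets_pair_measure_mono) (auto simp: space_F)

lemma diagonal_sets:
  assumes "Q \<in> sets (P \<Otimes>\<^sub>M P)"
  shows "{\<omega>\<in>space P. (\<omega>, \<omega>) \<in> Q} \<in> sets P"
proof -
  have "(\<lambda>\<omega>. (\<omega>, \<omega>)) \<in> P \<rightarrow>\<^sub>M P \<Otimes>\<^sub>M P" by measurable
  from measurable_sets[OF this assms] show ?thesis by (simp add: vimage_def Int_def conj_commute)
qed

lemma measurable_kernel_section: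
  assumes "Q \<in> sets (P \<Otimes>\<^sub>M P)"
  shows "(\<lambda>\<omega>. measure (\<kappa> \<omega>) (Pair \<omega> -` Q)) \<in> borel_measurable P"
    and "(\<lambda>\<omega>. emeasure (\<kappa> \<omega>) (Pair \<omega> -` Q)) \<in> borel_measurable P"
proof -
  have "(SIGMA \<omega>:space P. Pair \<omega> -` Q) = Q"
    using sets.sets_into_space[OF assms] by (auto simp: space_pair_measure)
  then have Sigma: "(SIGMA \<omega>:space P. Pair \<omega> -` Q) \<in> sets (P \<Otimes>\<^sub>M P)" using assms by simp
  show "(\<lambda>\<omega>. measure (\<kappa> \<omega>) (Pair \<omega> -` Q)) \<in> borel_measurable P"
    by (rule measure_measurable_subprob_algebra2[OF Sigma measurable_prob_algebraD[OF kernel_P]])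
  show "(\<lambda>\<omega>. emeasure (\<kappa> \<omega>) (Pair \<omega> -` Q)) \<in> borel_measurable P"
    by (rule emeasure_measurable_subprob_algebra2[OF Sigma measurable_prob_algebraD[OF kernel_P]])
qed

text \<open>
  Drawing \<open>\<omega>\<close> from \<open>P\<close> and then \<open>\<eta>\<close> from \<open>\<kappa> \<omega>\<close> yields a pair \<open>(\<omega>, \<eta>)\<close> with the same law on \<open>F \<Otimes> P\<close> as
  \<open>(\<omega>, \<omega>)\<close>. The defining property of \<open>\<kappa>\<close> is this statement for rectangles.
\<close>
lemma nn_integral_kernel_section:
  assumes Q: "Q \<in> sets (F \<Otimes>\<^sub>M P)"
  shows "(\<integral>\<^sup>+\<omega>. emeasure (\<kappa> \<omega>) (Pair \<omega> -` Q) \<partial>P) = emeasure P {\<omega>\<in>space P. (\<omega>, \<omega>) \<in> Q}"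
  using Int_stable_pair_measure_generator[of F P] pair_measure_closed[of F P] Q[unfolded sets_pair_measure]
proof (induction rule: sigma_sets_induct_disjoint)
  case (basic A)
  then obtain C B where A: "A = C \<times> B" and C: "C \<in> sets F" and B: "B \<in> sets P" by auto
  have CP: "C \<in> sets P" using C sets_F by auto
  have "(\<integral>\<^sup>+\<omega>. emeasure (\<kappa> \<omega>) (Pair \<omega> -` A) \<partial>P) = (\<integral>\<^sup>+\<omega>. indicator C \<omega> * measure (\<kappa> \<omega>) B \<partial>P)"
  proof (rule nn_integral_cong)
    fix \<omega> assume "\<omega> \<in> space P"
    then interpret k: prob_space "\<kappa> \<omega>" by (rule prob_space_kernel)
    show "emeasure (\<kappa> \<omega>) (Pair \<omega> -` A) = ennreal (indicator C \<omega> * measure (\<kappa> \<omega>) B)"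
      by (auto simp: A k.emeasure_eq_measure indicator_def)
  qed
  also have "\<dots> = ennreal (\<integral>\<omega>. indicator C \<omega> * measure (\<kappa> \<omega>) B \<partial>P)"
  proof (rule nn_integral_eq_integral)
    show "integrable P (\<lambda>\<omega>. indicator C \<omega> * measure (\<kappa> \<omega>) B)"
      using CP B prob_space_kernel
      by (intro integrable_const_bound[of _ 1]) (auto simp: indicator_def prob_space.prob_le_1)
  qed simp
  also have "(\<integral>\<omega>. indicator C \<omega> * measure (\<kappa> \<omega>) B \<partial>P) = prob (C \<inter> B)"
    using integral_kernel[OF B C] by (simp add: set_lebesgue_integral_def)
  also have "C \<inter> B = {\<omega>\<in>space P. (\<omega>, \<omega>) \<in> A}"
    using sets.sets_into_space[OF CP] by (auto simp: A)
  finally show ?case by (simp add: emeasure_eq_measure)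
next
  case empty
  show ?case by simp
next
  case (compl A)
  have A: "A \<in> sets (P \<Otimes>\<^sub>M P)" using compl.hyps sets_FP by (auto simp: sets_pair_measure)
  have "(\<integral>\<^sup>+\<omega>. emeasure (\<kappa> \<omega>) (Pair \<omega> -` (space F \<times> space P - A)) \<partial>P)
      = (\<integral>\<^sup>+\<omega>. 1 - emeasure (\<kappa> \<omega>) (Pair \<omega> -` A) \<partial>P)"
  proof (rule nn_integral_cong)
    fix \<omega> assume \<omega>: "\<omega> \<in> space P"
    then interpret k: prob_space "\<kappa> \<omega>" by (rule prob_space_kernel)
    have "Pair \<omega> -` (space F \<times> space P - A) = space (\<kappa> \<omega>) - Pair \<omega> -` A"
      using \<omega> by (auto simp: space_F space_kernel)
    then show "emeasure (\<kappa> \<omega>) (Pair \<omega> -` (space F \<times> space P - A)) = 1 - emeasure (\<kappa> \<omega>) (Pair \<omega> -` A)"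
      using sets_Pair1[OF A] \<omega> by (simp add: emeasure_compl sets_kernel k.emeasure_space_1)
  qed
  also have "\<dots> = (\<integral>\<^sup>+\<omega>. 1 \<partial>P) - (\<integral>\<^sup>+\<omega>. emeasure (\<kappa> \<omega>) (Pair \<omega> -` A) \<partial>P)"
    using measurable_kernel_section(2)[OF A] compl.IH
    by (intro nn_integral_diff) (auto intro!: prob_space.emeasure_le_1 prob_space_kernel)
  also have "\<dots> = 1 - emeasure P {\<omega>\<in>space P. (\<omega>, \<omega>) \<in> A}"
    using compl.IH by (simp add: emeasure_space_1)
  also have "\<dots> = emeasure P (space P - {\<omega>\<in>space P. (\<omega>, \<omega>) \<in> A})"
    using diagonal_sets[OF A] by (simp add: emeasure_compl emeasure_space_1)
  also have "space P - {\<omega>\<in>space P. (\<omega>, \<omega>) \<in> A} = {\<omega>\<in>space P. (\<omega>, \<omega>) \<in> space F \<times> space P - A}"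
    by (auto simp: space_F)
  finally show ?case .
next
  case (union A)
  have A: "A i \<in> sets (P \<Otimes>\<^sub>M P)" for i using union.hyps sets_FP by (auto simp: sets_pair_measure)
  have "(\<integral>\<^sup>+\<omega>. emeasure (\<kappa> \<omega>) (Pair \<omega> -` (\<Union>i. A i)) \<partial>P)
      = (\<integral>\<^sup>+\<omega>. (\<Sum>i. emeasure (\<kappa> \<omega>) (Pair \<omega> -` A i)) \<partial>P)"
  proof (rule nn_integral_cong)
    fix \<omega> assume \<omega>: "\<omega> \<in> space P"
    have "disjoint_family (\<lambda>i. Pair \<omega> -` A i)"
      using union.hyps(1) by (auto simp: disjoint_family_on_def)
    then show "emeasure (\<kappa> \<omega>) (Pair \<omega> -` (\<Union>i. A i)) = (\<Sum>i. emeasure (\<kappa> \<omega>) (Pair \<omega> -` A i))"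
      using sets_Pair1[OF A] \<omega> by (subst suminf_emeasure) (auto simp: sets_kernel vimage_UN)
  qed
  also have "\<dots> = (\<Sum>i. emeasure P {\<omega>\<in>space P. (\<omega>, \<omega>) \<in> A i})"
    using measurable_kernel_section(2)[OF A] union.IH by (simp add: nn_integral_suminf)
  also have "\<dots> = emeasure P (\<Union>i. {\<omega>\<in>space P. (\<omega>, \<omega>) \<in> A i})"
    using union.hyps(1) diagonal_sets[OF A]
    by (intro suminf_emeasure) (auto simp: disjoint_family_on_def)
  also have "(\<Union>i. {\<omega>\<in>space P. (\<omega>, \<omega>) \<in> A i}) = {\<omega>\<in>space P. (\<omega>, \<omega>) \<in> (\<Union>i. A i)}" by auto
  finally show ?case .
qed

lemma integrable_kernel_section:
  assumes "Q \<in> sets (P \<Otimes>\<^sub>M P)"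
  shows "integrable P (\<lambda>\<omega>. measure (\<kappa> \<omega>) (Pair \<omega> -` Q))"
  using measurable_kernel_section(1)[OF assms] prob_space_kernel
  by (intro integrable_const_bound[of _ 1]) (auto simp: prob_space.prob_le_1)

lemma integral_kernel_section:
  assumes Q: "Q \<in> sets (F \<Otimes>\<^sub>M P)"
  shows "(\<integral>\<omega>. measure (\<kappa> \<omega>) (Pair \<omega> -` Q) \<partial>P) = prob {\<omega>\<in>space P. (\<omega>, \<omega>) \<in> Q}"
proof -
  have QP: "Q \<in> sets (P \<Otimes>\<^sub>M P)" using Q sets_FP by auto
  have "ennreal (\<integral>\<omega>. measure (\<kappa> \<omega>) (Pair \<omega> -` Q) \<partial>P) = (\<integral>\<^sup>+\<omega>. measure (\<kappa> \<omega>) (Pair \<omega> -` Q) \<partial>P)"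
    using integrable_kernel_section[OF QP] by (intro nn_integral_eq_integral[symmetric]) auto
  also have "\<dots> = (\<integral>\<^sup>+\<omega>. emeasure (\<kappa> \<omega>) (Pair \<omega> -` Q) \<partial>P)"
    using prob_space_kernel
    by (intro nn_integral_cong) (simp add: finite_measure.emeasure_eq_measure prob_space.axioms(1))
  also have "\<dots> = ennreal (prob {\<omega>\<in>space P. (\<omega>, \<omega>) \<in> Q})"
    using nn_integral_kernel_section[OF Q] by (simp add: emeasure_eq_measure)
  finally show ?thesis by (simp add: integral_nonneg)
qed

text \<open>
  The quantitative form of Levy's zero-one law: if the event \<open>(\<omega>, \<omega>) \<in> Q\<close> nearly agrees with an
  event \<open>C\<close> of \<open>F\<close>, then its conditional probability is nearly the indicator of \<open>C\<close>. As the
  conditional probability \<open>a\<close> lies between \<open>0\<close> and \<open>1\<close>, one has \<open>\<bar>a - 1\<^sub>C\<bar> = 1\<^sub>C + a - 2 1\<^sub>C a\<close>,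
  where each term can be integrated exactly.
\<close>
lemma integral_kernel_section_minus_indicator:
  assumes Q: "Q \<in> sets (F \<Otimes>\<^sub>M P)" and C: "C \<in> sets F"
  shows "(\<integral>\<omega>. \<bar>measure (\<kappa> \<omega>) (Pair \<omega> -` Q) - indicator C \<omega>\<bar> \<partial>P)
    = prob (sym_diff {\<omega>\<in>space P. (\<omega>, \<omega>) \<in> Q} C)"
proof -
  define a where "a \<omega> = measure (\<kappa> \<omega>) (Pair \<omega> -` Q)" for \<omega>
  define D where "D = {\<omega>\<in>space P. (\<omega>, \<omega>) \<in> Q}"
  have QP: "Q \<in> sets (P \<Otimes>\<^sub>M P)" and CP: "C \<in> sets P" using Q C sets_FP sets_F by auto
  have DP: "D \<in> sets P" unfolding D_def by (rule diagonal_sets[OF QP])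
  have QC: "Q \<inter> (C \<times> space P) \<in> sets (F \<Otimes>\<^sub>M P)" using Q C by auto
  have fibre: "measure (\<kappa> \<omega>) (Pair \<omega> -` (Q \<inter> (C \<times> space P))) = indicator C \<omega> * a \<omega>"
    if "\<omega> \<in> space P" for \<omega>
  proof -
    have "Pair \<omega> -` Q \<subseteq> space P"
      using sets.sets_into_space[OF QP] by (auto simp: space_pair_measure)
    then have "Pair \<omega> -` (Q \<inter> (C \<times> space P)) = (if \<omega> \<in> C then Pair \<omega> -` Q else {})" by auto
    then show ?thesis by (cases "\<omega> \<in> C") (simp_all add: a_def)
  qed
  have int_a: "integrable P a" unfolding a_def by (rule integrable_kernel_section[OF QP])
  have int_Ca: "integrable P (\<lambda>\<omega>. indicator C \<omega> * a \<omega>)"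
    using integrable_mult_indicator[OF CP int_a] by simp
  have "(\<integral>\<omega>. indicator C \<omega> * a \<omega> \<partial>P) = prob {\<omega>\<in>space P. (\<omega>, \<omega>) \<in> Q \<inter> (C \<times> space P)}"
    unfolding integral_kernel_section[OF QC, symmetric]
    by (intro Bochner_Integration.integral_cong refl) (rule fibre[symmetric])
  also have "{\<omega>\<in>space P. (\<omega>, \<omega>) \<in> Q \<inter> (C \<times> space P)} = D \<inter> C" by (auto simp: D_def)
  finally have Ca: "(\<integral>\<omega>. indicator C \<omega> * a \<omega> \<partial>P) = prob (D \<inter> C)" .
  have "(\<integral>\<omega>. \<bar>a \<omega> - indicator C \<omega>\<bar> \<partial>P) = (\<integral>\<omega>. indicator C \<omega> + a \<omega> - 2 * (indicator C \<omega> * a \<omega>) \<partial>P)"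
  proof (rule Bochner_Integration.integral_cong)
    fix \<omega> assume "\<omega> \<in> space P"
    then have "0 \<le> a \<omega>" "a \<omega> \<le> 1"
      by (auto simp: a_def prob_space.prob_le_1[OF prob_space_kernel])
    then show "\<bar>a \<omega> - indicator C \<omega>\<bar> = indicator C \<omega> + a \<omega> - 2 * (indicator C \<omega> * a \<omega>)"
      by (auto simp: indicator_def)
  qed simp
  also have "\<dots> = prob C + prob D - 2 * prob (D \<inter> C)"
  proof -
    have "integrable P (\<lambda>\<omega>. indicator C \<omega> :: real)"
      using CP by (intro integrable_real_indicator) (auto simp: emeasure_eq_measure)
    moreover have "(\<integral>\<omega>. a \<omega> \<partial>P) = prob D"
      unfolding a_def D_def by (rule integral_kernel_section[OF Q])
    ultimately show ?thesis using int_a int_Ca Ca CP by simp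
  qed
  also have "\<dots> = prob (D - C) + prob (C - D)"
    using DP CP by (simp add: finite_measure_Diff' Int_commute)
  also have "\<dots> = prob (sym_diff D C)"
    using DP CP by (intro finite_measure_Union[symmetric]) auto
  finally show ?thesis unfolding a_def D_def .
qed

text \<open>
  Here \<open>T'\<close> is an approximation of \<open>T\<close> that is visible to \<open>F\<close>, with error \<open>J\<close> on the diagonal and \<open>R\<close>
  under \<open>P \<Otimes> P\<close>. The conditional probabilities of \<open>(\<omega>, \<omega>) \<in> T\<close> given \<open>\<omega>\<close> and of
  \<open>(\<omega>, \<omega>') \<in> T\<close> given \<open>\<omega>\<close> and the \<open>F\<close>-information on \<open>\<omega>'\<close> are close to the indicators of \<open>T'\<close>, with
  total mean error \<open>J + R\<close>. On the pairs where these indicators differ, the two conditional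
  probabilities therefore differ by almost \<open>1\<close>, except on a set controlled by Markov's inequality;
  this is the term \<open>(J + R) / \<delta>\<close>. The other \<open>J + R\<close> is the cost of passing from \<open>T\<close> to \<open>T'\<close>.
\<close>
lemma kernels_separated:
  assumes T: "T \<in> sets (F \<Otimes>\<^sub>M P)" and T': "T' \<in> sets (F \<Otimes>\<^sub>M F)" and \<delta>: "\<delta> > 0"
  defines "J \<equiv> prob {\<omega>\<in>space P. (\<omega>, \<omega>) \<in> sym_diff T T'}"
    and "R \<equiv> measure (P \<Otimes>\<^sub>M P) (sym_diff T T')"
  shows "measure (P \<Otimes>\<^sub>M P) {z\<in>space (P \<Otimes>\<^sub>M P). ((fst z, fst z) \<in> T) \<noteq> (z \<in> T)}
    \<le> measure (P \<Otimes>\<^sub>M P) {z\<in>space (P \<Otimes>\<^sub>M P).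
        1 - \<delta> < \<bar>measure (\<kappa> (fst z)) (Pair (fst z) -` T) - measure (\<kappa> (snd z)) (Pair (fst z) -` T)\<bar>}
      + (J + R) * (1 + 1 / \<delta>)"
proof -
  let ?PP = "P \<Otimes>\<^sub>M P"
  interpret PP: pair_prob_space P P ..
  have TP: "T \<in> sets ?PP" and T'P: "T' \<in> sets ?PP" using T T' sets_FP sets_FF by auto
  define D where "D = {\<omega>\<in>space P. (\<omega>, \<omega>) \<in> T}"
  define C where "C = {\<omega>\<in>space P. (\<omega>, \<omega>) \<in> T'}"
  have DP: "D \<in> sets P" and CP: "C \<in> sets P"
    unfolding D_def C_def by (rule diagonal_sets[OF TP] diagonal_sets[OF T'P])+
  have CF: "C \<in> sets F"
  proof -
    have "(\<lambda>\<omega>. (\<omega>, \<omega>)) \<in> F \<rightarrow>\<^sub>M F \<Otimes>\<^sub>M F" by measurable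
    from measurable_sets[OF this T'] show ?thesis
      by (simp add: C_def vimage_def Int_def conj_commute space_F)
  qed
  define a where "a \<omega> = measure (\<kappa> \<omega>) (Pair \<omega> -` T)" for \<omega>
  define b where "b z = measure (\<kappa> (snd z)) (Pair (fst z) -` T)" for z
  \<comment> \<open>The prediction errors for the two events, one for each observer.\<close>
  define u where "u z = \<bar>a (fst z) - indicator C (fst z)\<bar>" for z :: "'b \<times> 'b"
  define v where "v z = \<bar>b z - indicator T' z\<bar>" for z
  have a_meas [measurable]: "a \<in> borel_measurable P"
    unfolding a_def by (rule measurable_kernel_section(1)[OF TP])
  have b_meas [measurable]: "b \<in> borel_measurable ?PP"
    unfolding b_def
  proof (rule measure_measurable_subprob_algebra2)
    have "(\<lambda>(z, \<eta>). (fst z, \<eta>)) \<in> ?PP \<Otimes>\<^sub>M P \<rightarrow>\<^sub>M ?PP" by measurable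
    from measurable_sets[OF this TP]
    show "(SIGMA z:space ?PP. Pair (fst z) -` T) \<in> sets (?PP \<Otimes>\<^sub>M P)"
      using sets.sets_into_space[OF TP]
      by (elim back_subst[of "\<lambda>A. A \<in> sets (?PP \<Otimes>\<^sub>M P)"]) (auto simp: space_pair_measure)
    show "(\<lambda>z. \<kappa> (snd z)) \<in> ?PP \<rightarrow>\<^sub>M subprob_algebra P"
      by (intro measurable_prob_algebraD measurable_compose[OF measurable_snd kernel_P])
  qed
  have unit: "0 \<le> a \<omega>" "a \<omega> \<le> 1" if "\<omega> \<in> space P" for \<omega>
    using that by (auto simp: a_def prob_space.prob_le_1[OF prob_space_kernel])
  have unit_b: "0 \<le> b z" "b z \<le> 1" if "z \<in> space ?PP" for z
    using that by (auto simp: b_def space_pair_measure prob_space.prob_le_1[OF prob_space_kernel])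
  have u_meas [measurable]: "u \<in> borel_measurable ?PP" unfolding u_def using CP by measurable
  have v_meas [measurable]: "v \<in> borel_measurable ?PP" unfolding v_def using T'P by measurable
  have nonneg: "0 \<le> u z" "0 \<le> v z" for z by (simp_all add: u_def v_def)
  have int_u: "integrable ?PP u"
  proof (intro PP.integrable_const_bound[of _ 1] AE_I2 u_meas)
    fix z assume "z \<in> space ?PP"
    then have "fst z \<in> space P" by (auto simp: space_pair_measure)
    then show "norm (u z) \<le> 1" using unit[of "fst z"] by (simp add: u_def indicator_def)
  qed
  have int_v: "integrable ?PP v"
  proof (intro PP.integrable_const_bound[of _ 1] AE_I2 v_meas)
    fix z assume "z \<in> space ?PP"
    then show "norm (v z) \<le> 1" using unit_b[of z] by (simp add: v_def indicator_def)
  qed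
  have Eu: "(\<integral>z. u z \<partial>?PP) = J"
  proof -
    have "(\<integral>z. u z \<partial>?PP) = (\<integral>\<omega>. \<bar>a \<omega> - indicator C \<omega>\<bar> \<partial>distr ?PP P fst)"
      unfolding u_def using CP by (intro integral_distr[symmetric]) auto
    also have "\<dots> = prob (sym_diff D C)"
      unfolding distr_pair_fst a_def D_def by (rule integral_kernel_section_minus_indicator[OF T CF])
    also have "sym_diff D C = {\<omega>\<in>space P. (\<omega>, \<omega>) \<in> sym_diff T T'}" by (auto simp: D_def C_def)
    finally show ?thesis by (simp add: J_def)
  qed
  have Ev: "(\<integral>z. v z \<partial>?PP) = R"
  proof -
    have "(\<integral>\<omega>'. v (\<omega>, \<omega>') \<partial>P) = (\<integral>\<omega>'. indicator (sym_diff T T') (\<omega>, \<omega>') \<partial>P)"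
      if \<omega>: "\<omega> \<in> space P" for \<omega>
    proof -
      define B where "B = Pair \<omega> -` T"
      define B' where "B' = Pair \<omega> -` T'"
      have B: "B \<in> sets P" and B': "B' \<in> sets F"
        unfolding B_def B'_def using T T' by (auto intro: sets_Pair1)
      have Q: "space P \<times> B \<in> sets (F \<Otimes>\<^sub>M P)" using B by (auto simp: space_F[symmetric])
      have "(\<integral>\<omega>'. v (\<omega>, \<omega>') \<partial>P)
          = (\<integral>\<omega>'. \<bar>measure (\<kappa> \<omega>') (Pair \<omega>' -` (space P \<times> B)) - indicator B' \<omega>'\<bar> \<partial>P)"
        by (intro Bochner_Integration.integral_cong)
          (auto simp: v_def b_def B_def B'_def indicator_def)
      also have "\<dots> = prob (sym_diff {\<omega>'\<in>space P. (\<omega>', \<omega>') \<in> space P \<times> B} B')"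
        by (rule integral_kernel_section_minus_indicator[OF Q B'])
      also have "{\<omega>'\<in>space P. (\<omega>', \<omega>') \<in> space P \<times> B} = B"
        using sets.sets_into_space[OF B] by auto
      also have "prob (sym_diff B B') = (\<integral>\<omega>'. indicator (sym_diff B B') \<omega>' \<partial>P)"
        using sets.sets_into_space[OF B] sets.sets_into_space[OF B'] by (simp add: Int_absorb2 space_F le_supI Diff_subset_conv le_supI2)
      also have "\<dots> = (\<integral>\<omega>'. indicator (sym_diff T T') (\<omega>, \<omega>') \<partial>P)"
        by (intro Bochner_Integration.integral_cong) (auto simp: B_def B'_def indicator_def)
      finally show ?thesis .
    qed
    then have "(\<integral>\<omega>. (\<integral>\<omega>'. v (\<omega>, \<omega>') \<partial>P) \<partial>P)
        = (\<integral>\<omega>. (\<integral>\<omega>'. indicator (sym_diff T T') (\<omega>, \<omega>') \<partial>P) \<partial>P)"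
      by (rule Bochner_Integration.integral_cong[OF refl])
    then have "(\<integral>z. v z \<partial>?PP) = (\<integral>z. indicator (sym_diff T T') z \<partial>?PP)"
      using int_v TP T'P by (subst (asm) (1 2) PP.integral_fst') (auto simp: PP.emeasure_eq_measure)
    then show ?thesis
      using TP T'P by (simp add: R_def Int_absorb2 sets.sets_into_space)
  qed
  \<comment> \<open>\<open>Y\<close> collects the bad predictions, \<open>Z\<close> the pairs where \<open>T\<close> and \<open>T'\<close> differ on the diagonal.\<close>
  define X where "X = {z\<in>space ?PP. 1 - \<delta> < \<bar>a (fst z) - b z\<bar>}"
  define Y where "Y = {z\<in>space ?PP. \<delta> \<le> u z + v z}"
  define Z where "Z = fst -` (sym_diff D C) \<inter> space ?PP"
  have X: "X \<in> sets ?PP" and Y: "Y \<in> sets ?PP" unfolding X_def Y_def by measurable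
  have Z: "Z \<in> sets ?PP"
    unfolding Z_def using DP CP by (intro measurable_sets[OF measurable_fst]) auto
  have W: "sym_diff T T' \<in> sets ?PP" using TP T'P by auto
  have mZ: "measure ?PP Z = J"
  proof -
    have "measure ?PP Z = measure (distr ?PP P fst) (sym_diff D C)"
      unfolding Z_def using DP CP by (intro measure_distr[symmetric]) auto
    also have "\<dots> = J"
      unfolding distr_pair_fst J_def D_def C_def by (intro arg_cong[where f=prob]) auto
    finally show ?thesis .
  qed
  have "measure ?PP Y \<le> (\<integral>z. u z + v z \<partial>?PP) / \<delta>"
    unfolding Y_def using int_u int_v \<delta>
    by (intro integral_Markov_inequality_measure[where A="space ?PP"]) (auto simp: nonneg)
  then have mY: "measure ?PP Y \<le> (J + R) / \<delta>" using int_u int_v Eu Ev by simp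
  have "measure ?PP {z\<in>space ?PP. ((fst z, fst z) \<in> T) \<noteq> (z \<in> T)} \<le> measure ?PP (X \<union> (Y \<union> (Z \<union> sym_diff T T')))"
  proof (rule PP.finite_measure_mono)
    show "{z\<in>space ?PP. ((fst z, fst z) \<in> T) \<noteq> (z \<in> T)} \<subseteq> X \<union> (Y \<union> (Z \<union> sym_diff T T'))"
    proof (rule subsetI, rule ccontr)
      fix z assume z: "z \<in> {z\<in>space ?PP. ((fst z, fst z) \<in> T) \<noteq> (z \<in> T)}"
        and nin: "z \<notin> X \<union> (Y \<union> (Z \<union> sym_diff T T'))"
      have fz: "fst z \<in> space P" and zP: "z \<in> space ?PP" using z by (auto simp: space_pair_measure)
      have "fst z \<in> C \<longleftrightarrow> z \<notin> T'" using z nin fz by (auto simp: Z_def D_def C_def)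
      moreover have "u z + v z < \<delta>" "\<bar>a (fst z) - b z\<bar> \<le> 1 - \<delta>" using nin zP by (auto simp: X_def Y_def)
      ultimately show False unfolding u_def v_def by (auto simp: indicator_def split: if_splits)
    qed
  qed (use X Y Z W in auto)
  also have "\<dots> \<le> measure ?PP X + (measure ?PP Y + (measure ?PP Z + measure ?PP (sym_diff T T')))"
    using X Y Z W
    by (intro order_trans[OF measure_Un_le] add_mono order_refl) auto
  also have "\<dots> \<le> measure ?PP X + (J + R) * (1 + 1 / \<delta>)"
    using mY mZ by (simp add: R_def algebra_simps add_divide_distrib)
  finally show ?thesis unfolding X_def a_def b_def .
qed

end

section \<open>Total variation on a \<open>\<sigma>\<close>-field\<close>

lemma measure_diff_le_abs:
  assumes "prob_space \<mu>" "prob_space \<nu>" and sets: "sets \<nu> = sets \<mu>" and A: "A \<in> sets \<mu>"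
    and le: "measure \<mu> A - measure \<nu> A \<le> c" "measure \<mu> (space \<mu> - A) - measure \<nu> (space \<mu> - A) \<le> c"
  shows "\<bar>measure \<mu> A - measure \<nu> A\<bar> \<le> c"
proof -
  interpret \<mu>: prob_space \<mu> by fact
  interpret \<nu>: prob_space \<nu> by fact
  show ?thesis
    using le A sets \<mu>.prob_compl[of A] \<nu>.prob_compl[of A] sets_eq_imp_space_eq[OF sets] by auto
qed

lemma bdd_above_measure_diff:
  assumes "prob_space \<mu>" "prob_space \<nu>"
  shows "bdd_above ((\<lambda>A. \<bar>measure \<mu> A - measure \<nu> A\<bar>) ` G)"
proof (rule bdd_aboveI2)
  interpret \<mu>: prob_space \<mu> by fact
  interpret \<nu>: prob_space \<nu> by fact
  fix A
  show "\<bar>measure \<mu> A - measure \<nu> A\<bar> \<le> 1"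
    using \<mu>.prob_le_1[of A] \<nu>.prob_le_1[of A] measure_nonneg[of \<mu> A] measure_nonneg[of \<nu> A] by linarith
qed

lemma tv_norm_on_upper:
  assumes "prob_space \<mu>" "prob_space \<nu>" "A \<in> \<G>"
  shows "2 * \<bar>measure \<mu> A - measure \<nu> A\<bar> \<le> tv_norm_on \<G> \<mu> \<nu>"
  unfolding tv_norm_on_def
  using cSUP_upper[OF assms(3) bdd_above_measure_diff[OF assms(1,2)]] by simp

lemma tv_norm_on_least:
  assumes "\<G> \<noteq> {}" "\<And>A. A \<in> \<G> \<Longrightarrow> \<bar>measure \<mu> A - measure \<nu> A\<bar> \<le> c"
  shows "tv_norm_on \<G> \<mu> \<nu> \<le> 2 * c"
  unfolding tv_norm_on_def using cSUP_least[OF assms] by simp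

lemma tv_norm_on_nonneg:
  assumes "prob_space \<mu>" "prob_space \<nu>" "{} \<in> \<G>"
  shows "0 \<le> tv_norm_on \<G> \<mu> \<nu>"
  using tv_norm_on_upper[OF assms] by simp

text \<open>
  Total variation is continuous along decreasing \<open>\<sigma>\<close>-fields: a positive limit would be realised
  on a set in the intersection.
\<close>
lemma sup_measure_diff_tendsto_0:
  assumes "prob_space \<mu>" "prob_space \<nu>" and sets_eq: "sets \<nu> = sets \<mu>"
    and alg: "\<And>k. sigma_algebra (space \<mu>) (G k)" and dec: "antimono (G :: nat \<Rightarrow> _)"
    and sub: "\<And>k. G k \<subseteq> sets \<mu>"
    and agree: "\<And>S. S \<in> (\<Inter>k. G k) \<Longrightarrow> measure \<mu> S = measure \<nu> S"
  shows "(\<lambda>k. SUP S\<in>G k. \<bar>measure \<mu> S - measure \<nu> S\<bar>) \<longlonglongrightarrow> 0"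
proof -
  interpret \<mu>: prob_space \<mu> by fact
  interpret \<nu>: prob_space \<nu> by fact
  interpret G: sigma_algebra "space \<mu>" "G k" for k by (rule alg)
  define top where "top k = (SUP S\<in>G k. \<bar>measure \<mu> S - measure \<nu> S\<bar>)" for k
  note bdd = bdd_above_measure_diff[OF assms(1,2)]
  have ne: "G k \<noteq> {}" for k by auto
  have nonneg: "0 \<le> top k" for k
    unfolding top_def using cSUP_upper[OF _ bdd, of "{}" "G k"] by simp
  have decs: "decseq top"
    unfolding top_def decseq_def using dec
    by (intro allI impI cSUP_subset_mono ne bdd) (auto dest: antimonoD)
  have bb: "bdd_below (range top)" using nonneg by (intro bdd_belowI2)
  define L where "L = (INF k. top k)"
  have lim: "top \<longlonglongrightarrow> L" unfolding L_def by (rule LIMSEQ_decseq_INF[OF bb decs])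
  have "\<exists>S\<in>(\<Inter>k. G k). L \<le> measure \<mu> S - measure \<nu> S"
  proof (rule near_maximal_set_in_intersection)
    fix k and e :: real assume "e > 0"
    then have "L - e < top k" unfolding L_def using cINF_lower[OF bb, of k] by simp
    then obtain S where S: "S \<in> G k" "L - e < \<bar>measure \<mu> S - measure \<nu> S\<bar>"
      unfolding top_def using less_cSUP_iff[OF ne bdd] by blast
    have "S \<in> sets \<mu>" "space \<mu> - S \<in> G k" using S(1) sub by auto
    then show "\<exists>S\<in>G k. L - e < measure \<mu> S - measure \<nu> S"
      using measure_diff_le_abs[OF assms(1,2) sets_eq, of S "L - e"] S by force
  qed (use alg dec sub sets_eq in \<open>auto intro: \<mu>.finite_measure_axioms \<nu>.finite_measure_axioms\<close>)
  then have "L \<le> 0" using agree by fastforce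
  moreover have "L \<ge> 0" using lim nonneg by (intro LIMSEQ_le_const) auto
  ultimately show ?thesis using lim unfolding top_def by simp
qed

text \<open>
  The supremum \<open>1\<close> of \<open>\<mu> - \<nu>\<close> is attained, by the case of a constant family of \<open>\<sigma>\<close>-fields of
  \<open>near_maximal_set_in_intersection\<close>, and a set attaining it carries \<open>\<mu>\<close> and is null for \<open>\<nu>\<close>.
\<close>
lemma singular_of_sup_eq_1:
  assumes "prob_space \<mu>" "prob_space \<nu>" and sets_eq: "sets \<nu> = sets \<mu>"
    and alg: "sigma_algebra (space \<mu>) \<G>" and sub: "\<G> \<subseteq> sets \<mu>"
    and near: "\<And>e. (e::real) > 0 \<Longrightarrow> \<exists>S\<in>\<G>. 1 - e < measure \<mu> S - measure \<nu> S"
  shows "mutually_singular_on \<G> \<mu> \<nu>"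
proof -
  interpret \<mu>: prob_space \<mu> by fact
  interpret \<nu>: prob_space \<nu> by fact
  interpret G: sigma_algebra "space \<mu>" \<G> by fact
  have "\<exists>S\<in>(\<Inter>k::nat. \<G>). 1 \<le> measure \<mu> S - measure \<nu> S"
    using assms near by (intro near_maximal_set_in_intersection)
      (auto intro: \<mu>.finite_measure_axioms \<nu>.finite_measure_axioms simp: antimono_def)
  then obtain S where S: "S \<in> \<G>" "1 \<le> measure \<mu> S - measure \<nu> S" by auto
  have SM: "S \<in> sets \<mu>" and space: "space \<nu> = space \<mu>"
    using S(1) sub sets_eq_imp_space_eq[OF sets_eq] by auto
  have "measure \<mu> S = 1" "measure \<nu> S = 0"
    using S(2) \<mu>.prob_le_1[of S] measure_nonneg[of \<nu> S] by linarith+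
  then have "emeasure \<mu> (space \<mu> - S) = 0" "emeasure \<nu> S = 0"
    using \<mu>.prob_compl[OF SM] by (simp_all add: \<mu>.emeasure_eq_measure \<nu>.emeasure_eq_measure)
  moreover have "space \<nu> - (space \<mu> - S) = S"
    using sets.sets_into_space[OF SM] space by auto
  ultimately show ?thesis
    unfolding mutually_singular_on_def using S(1) by (intro bexI[of _ "space \<mu> - S"]) auto
qed

section \<open>Time shifts\<close>

definition delay :: "nat \<Rightarrow> (int \<Rightarrow> 'a) \<Rightarrow> int \<Rightarrow> 'a" where
  "delay n \<omega> = (\<lambda>k. \<omega> (k - int n))"

lemma delay_measurable_gen_alg:
  assumes "\<And>k. k \<in> I \<Longrightarrow> k - int n \<in> L"
  shows "delay n \<in> gen_alg L \<rightarrow>\<^sub>M gen_alg I"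
  unfolding delay_def using assms by (intro measurable_gen_algI measurable_coordinate_gen_alg) auto

lemma delay_measurable [measurable]: "delay n \<in> paths UNIV \<rightarrow>\<^sub>M paths UNIV"
  using delay_measurable_gen_alg[of UNIV n UNIV]
  by (simp cong: measurable_cong_sets add: sets_gen_alg_UNIV)

lemma shift_measurable [measurable]: "shift \<in> paths UNIV \<rightarrow>\<^sub>M paths UNIV"
  unfolding shift_def by (intro measurable_PiM_single') (auto simp: space_PiM)

lemma distr_delay:
  assumes "sets P = sets (paths UNIV)" "distr P (paths UNIV) shift = P"
  shows "distr P (paths UNIV) (delay n) = P"
proof (induction n)
  case 0
  have "delay 0 = (\<lambda>\<omega> :: int \<Rightarrow> 'a. \<omega>)" by (auto simp: delay_def)
  then show ?case using assms by (simp add: distr_id2)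
next
  case (Suc n)
  note [measurable_cong] = assms(1)
  have "distr P (paths UNIV) (delay (Suc n)) = distr (distr P (paths UNIV) shift) (paths UNIV) (delay (Suc n))"
    by (simp add: assms(2))
  also have "\<dots> = distr P (paths UNIV) (delay (Suc n) \<circ> shift)"
    by (intro distr_distr) measurable
  also have "delay (Suc n) \<circ> shift = delay n"
    by (auto simp: delay_def shift_def algebra_simps)
  finally show ?case using Suc.IH by simp
qed

section \<open>Stationary laws and their conditional laws given the past\<close>

locale stationary_past =
  fixes P :: "(int \<Rightarrow> 'a::polish_space) measure"
    and K :: "(int \<Rightarrow> 'a) \<Rightarrow> (int \<Rightarrow> 'a) measure"
  assumes stationary: "stationary_law P"
    and version: "reg_cond_prob_past P K"
begin

lemma sets_P: "sets P = sets (paths UNIV)" and prob_P: "prob_space P"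
  using stationary by (auto simp: stationary_law_def space_prob_algebra)

lemmas sets_P_cong [measurable_cong] = sets_P

lemma space_P: "space P = UNIV"
  using sets_eq_imp_space_eq[OF sets_P] by (simp add: space_PiM)

sublocale prob_space P by (rule prob_P)

sublocale PP: pair_prob_space P P ..

definition \<kappa> :: "(int \<Rightarrow> 'a) \<Rightarrow> (int \<Rightarrow> 'a) measure" where
  "\<kappa> \<omega> = K (coord {..0} \<omega>)"

lemma gen_alg_in_P: "sets (gen_alg I) \<subseteq> sets P"
  using gen_alg_subset[of I] sets_P by auto

lemma coord_P [measurable]: "coord I \<in> P \<rightarrow>\<^sub>M paths I"
  using coord_measurable[of I] sets_P by (simp cong: measurable_cong_sets)

lemma K_measurable: "K \<in> paths {..0} \<rightarrow>\<^sub>M prob_algebra (paths UNIV)"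
  using version by (simp add: reg_cond_prob_past_def)

lemma subalgebra_past: "subalgebra P (gen_alg {..0})"
  using gen_alg_in_P by (auto simp: subalgebra_def space_P)

lemma prob_algebra_P: "prob_algebra P = prob_algebra (paths UNIV)"
  unfolding prob_algebra_def subprob_algebra_cong[OF sets_P] ..

lemma \<kappa>_measurable: "\<kappa> \<in> gen_alg {..0} \<rightarrow>\<^sub>M prob_algebra P"
  unfolding \<kappa>_def prob_algebra_P by (rule measurable_compose[OF coord_measurable_gen_alg K_measurable])

lemma integral_\<kappa>:
  assumes A: "A \<in> sets P" and C: "C \<in> sets (gen_alg {..0})"
  shows "(\<integral>\<omega>\<in>C. measure (\<kappa> \<omega>) A \<partial>P) = prob (C \<inter> A)"
proof -
  interpret F: finite_measure_subalgebra P "gen_alg {..0}"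
    by unfold_locales (rule subalgebra_past)
  have CP: "C \<in> sets P" using C gen_alg_in_P by auto
  have \<kappa>A [measurable]: "(\<lambda>\<omega>. measure (\<kappa> \<omega>) A) \<in> borel_measurable P"
    using measurable_compose[OF measurable_from_subalg[OF subalgebra_past \<kappa>_measurable] measurable_measure_prob_algebra[OF A]] .
  have "AE \<omega> in P. measure (\<kappa> \<omega>) A = real_cond_exp P (gen_alg {..0}) (indicator A) \<omega>"
    using version A unfolding \<kappa>_def reg_cond_prob_past_def sets_P by blast
  then have "(\<integral>\<omega>\<in>C. measure (\<kappa> \<omega>) A \<partial>P)
      = (\<integral>\<omega>\<in>C. real_cond_exp P (gen_alg {..0}) (indicator A) \<omega> \<partial>P)"
    unfolding set_lebesgue_integral_def using CP by (intro integral_cong_AE) auto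
  also have "\<dots> = (\<integral>\<omega>\<in>C. indicator A \<omega> \<partial>P)"
    using A C by (intro F.real_cond_exp_intA[symmetric] integrable_real_indicator) (auto simp: emeasure_eq_measure)
  also have "\<dots> = (\<integral>\<omega>. indicator (C \<inter> A) \<omega> \<partial>P)"
    by (simp add: set_lebesgue_integral_def indicator_inter_arith)
  also have "\<dots> = prob (C \<inter> A)" by (simp add: space_P)
  finally show ?thesis .
qed

sublocale regular_conditional_kernel P "gen_alg {..0}" \<kappa>
  by unfold_locales (fact subalgebra_past \<kappa>_measurable integral_\<kappa>)+

lemma K_prob:
  assumes "x \<in> space (paths {..0})"
  shows "prob_space (K x)" "sets (K x) = sets P" "space (K x) = UNIV"
  using measurable_space[OF K_measurable assms] sets_P sets_eq_imp_space_eq[of "K x" P] space_P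
  by (auto simp: space_prob_algebra)

lemma \<kappa>_prob: "prob_space (\<kappa> \<omega>)" "sets (\<kappa> \<omega>) = sets P" "space (\<kappa> \<omega>) = UNIV"
  using K_prob[of "coord {..0} \<omega>"] unfolding \<kappa>_def by (auto simp: coord_def space_PiM)

lemma prob_law: "prob_space (law_on P I)"
  unfolding law_on_def by (intro prob_space_distr) measurable

text \<open>
  Past and remote future are regarded as \<open>\<sigma>\<close>-fields on pairs of full paths. The joint law then lives
  on the diagonal, the product law is \<open>P \<Otimes> P\<close>, and neither space changes with \<open>k\<close>.
\<close>
abbreviation both :: "nat \<Rightarrow> ((int \<Rightarrow> 'a) \<times> (int \<Rightarrow> 'a)) measure" where
  "both k \<equiv> gen_alg {..0} \<Otimes>\<^sub>M gen_alg {int k..}"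

lemma both_in_PP: "sets (both k) \<subseteq> sets (P \<Otimes>\<^sub>M P)"
  by (intro sets_pair_measure_mono gen_alg_in_P) (simp_all add: space_P)

abbreviation joint :: "nat \<Rightarrow> ((int \<Rightarrow> 'a) \<times> (int \<Rightarrow> 'a)) measure" where
  "joint k \<equiv> distr P (paths {..0} \<Otimes>\<^sub>M paths {int k..}) (\<lambda>\<omega>. (coord {..0} \<omega>, coord {int k..} \<omega>))"

abbreviation product :: "nat \<Rightarrow> ((int \<Rightarrow> 'a) \<times> (int \<Rightarrow> 'a)) measure" where
  "product k \<equiv> law_on P {..0} \<Otimes>\<^sub>M law_on P {int k..}"

lemma prob_joint: "prob_space (joint k)"
  by (rule prob_space_distr) measurable

lemma prob_product: "prob_space (product k)"
proof -
  interpret L: pair_prob_space "law_on P {..0}" "law_on P {int k..}"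
    unfolding pair_prob_space_def pair_sigma_finite_def
    by (auto intro: prob_law prob_space_imp_sigma_finite)
  show ?thesis by (rule L.prob_space_axioms)
qed

lemma measure_joint:
  assumes "A \<in> sets (paths {..0} \<Otimes>\<^sub>M paths {int k..})"
  shows "measure (joint k) A
    = prob {\<omega>. (coord {..0} \<omega>, coord {int k..} \<omega>) \<in> A}"
proof -
  have "(\<lambda>\<omega>. (coord {..0} \<omega>, coord {int k..} \<omega>)) \<in> P \<rightarrow>\<^sub>M paths {..0} \<Otimes>\<^sub>M paths {int k..}" by measurable
  from measure_distr[OF this assms] show ?thesis by (simp add: space_P vimage_def)
qed

lemma measure_product:
  assumes "A \<in> sets (paths {..0} \<Otimes>\<^sub>M paths {int k..})"
  shows "measure (product k) A
    = measure (P \<Otimes>\<^sub>M P) {z. (coord {..0} (fst z), coord {int k..} (snd z)) \<in> A}"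
proof -
  have "law_on P {..0} \<Otimes>\<^sub>M law_on P {int k..}
      = distr (P \<Otimes>\<^sub>M P) (paths {..0} \<Otimes>\<^sub>M paths {int k..}) (\<lambda>(x, y). (coord {..0} x, coord {int k..} y))"
    unfolding law_on_def
    by (intro pair_measure_distr prob_space_imp_sigma_finite prob_space_distr) measurable
  moreover have "(\<lambda>(x, y). (coord {..0} x, coord {int k..} y)) \<in> P \<Otimes>\<^sub>M P \<rightarrow>\<^sub>M paths {..0} \<Otimes>\<^sub>M paths {int k..}"
    by measurable
  ultimately show ?thesis
    using assms by (simp add: measure_distr vimage_def space_pair_measure space_P case_prod_beta)
qed

section \<open>Non-singular conditional laws imply regularity\<close>

lemma tail_set_of_not_regular:
  assumes "\<not> absolutely_regular P"
  shows "\<exists>S. (\<forall>k. S \<in> sets (both k)) \<and> prob {\<omega>. (\<omega>, \<omega>) \<in> S} \<noteq> measure (P \<Otimes>\<^sub>M P) S"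
proof (rule ccontr)
  assume contr: "\<not> ?thesis"
  define \<mu> where "\<mu> = distr P (P \<Otimes>\<^sub>M P) (\<lambda>\<omega>. (\<omega>, \<omega>))"
  have diag: "(\<lambda>\<omega>. (\<omega>, \<omega>)) \<in> P \<rightarrow>\<^sub>M P \<Otimes>\<^sub>M P" by measurable
  have \<mu>: "measure \<mu> S = prob {\<omega>. (\<omega>, \<omega>) \<in> S}" if "S \<in> sets (P \<Otimes>\<^sub>M P)" for S
    unfolding \<mu>_def using measure_distr[OF diag that] by (simp add: space_P vimage_def)
  have prob_\<mu>: "prob_space \<mu>" unfolding \<mu>_def by (rule prob_space_distr[OF diag])
  have space: "space \<mu> = UNIV" by (simp add: \<mu>_def space_pair_measure space_P)
  let ?top = "\<lambda>k. SUP S\<in>sets (both k). \<bar>measure \<mu> S - measure (P \<Otimes>\<^sub>M P) S\<bar>"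
  have lim: "?top \<longlonglongrightarrow> 0"
  proof (rule sup_measure_diff_tendsto_0[OF prob_\<mu> PP.prob_space_axioms])
    show "sigma_algebra (space \<mu>) (sets (both k))" for k
      using sets.sigma_algebra_axioms[of "both k"] by (simp add: space space_pair_measure)
    show "antimono (\<lambda>k. sets (both k))"
      by (intro antimonoI sets_pair_gen_alg_mono) auto
    show "measure \<mu> S = measure (P \<Otimes>\<^sub>M P) S" if "S \<in> (\<Inter>k. sets (both k))" for S
      using contr that both_in_PP by (subst \<mu>) auto
  qed (use both_in_PP in \<open>auto simp: \<mu>_def\<close>)
  have le: "tv_norm (joint k) (product k) \<le> 2 * ?top k" (is "tv_norm ?J ?R \<le> _") for k
  proof -
    have "\<bar>measure ?J A - measure ?R A\<bar> \<le> ?top k" if "A \<in> sets ?J" for A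
    proof -
      have A: "A \<in> sets (paths {..0} \<Otimes>\<^sub>M paths {int k..})" using that by simp
      define S where "S = {z. (coord {..0} (fst z), coord {int k..} (snd z)) \<in> A}"
      have "(\<lambda>z. (coord {..0} (fst z), coord {int k..} (snd z))) \<in> both k \<rightarrow>\<^sub>M paths {..0} \<Otimes>\<^sub>M paths {int k..}"
        by measurable
      from measurable_sets[OF this A] have S: "S \<in> sets (both k)"
        by (simp add: S_def vimage_def space_pair_measure)
      have "measure ?J A = measure \<mu> S"
        using S both_in_PP unfolding measure_joint[OF A] by (subst \<mu>) (auto simp: S_def)
      moreover have "measure ?R A = measure (P \<Otimes>\<^sub>M P) S"
        unfolding measure_product[OF A] S_def ..
      ultimately show ?thesis
        using cSUP_upper[OF S bdd_above_measure_diff[OF prob_\<mu> PP.prob_space_axioms]] by simp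
    qed
    then show ?thesis unfolding tv_norm_def by (intro tv_norm_on_least) auto
  qed
  have ge: "0 \<le> tv_norm (joint k) (product k)" for k
    unfolding tv_norm_def by (intro tv_norm_on_nonneg prob_joint prob_product) simp
  have "(\<lambda>k. 2 * ?top k) \<longlonglongrightarrow> 0" by (rule tendsto_mult_right_zero[OF lim])
  then have "(\<lambda>k. tv_norm (joint k) (product k)) \<longlonglongrightarrow> 0"
    by (rule tendsto_sandwich[OF always_eventually[OF allI[OF ge]] always_eventually[OF allI[OF le]] tendsto_const])
  then have "absolutely_regular P" unfolding absolutely_regular_def .
  with assms show False ..
qed

text \<open>
  The past at time \<open>n\<close>, as \<open>n\<close> grows, exhausts all coordinates, so every event is approximated by
  events of a finite time horizon, here under the joint and the product law simultaneously.
\<close>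
lemma approx_by_past_sets:
  assumes S: "S \<in> sets (both m)" and e: "e > 0"
  obtains n S' where "S' \<in> sets (gen_alg {..0} \<Otimes>\<^sub>M gen_alg {..int n})"
    "prob {\<omega>. (\<omega>, \<omega>) \<in> sym_diff S S'} < e" "measure (P \<Otimes>\<^sub>M P) (sym_diff S S') < e"
proof -
  define F where "F n = sets (gen_alg {..0} \<Otimes>\<^sub>M gen_alg {..int n} :: ((int \<Rightarrow> 'a) \<times> (int \<Rightarrow> 'a)) measure)" for n
  define \<mu> where "\<mu> = distr P (P \<Otimes>\<^sub>M P) (\<lambda>\<omega>. (\<omega>, \<omega>))"
  have diag: "(\<lambda>\<omega>. (\<omega>, \<omega>)) \<in> P \<rightarrow>\<^sub>M P \<Otimes>\<^sub>M P" by measurable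
  interpret \<mu>: prob_space \<mu> unfolding \<mu>_def by (rule prob_space_distr[OF diag])
  have space: "space \<mu> = UNIV" by (simp add: \<mu>_def space_pair_measure space_P)
  have F_sub: "F n \<subseteq> sets (P \<Otimes>\<^sub>M P)" for n
    unfolding F_def by (intro sets_pair_measure_mono gen_alg_in_P) (simp_all add: space_P)
  let ?N = "sigma UNIV (\<Union>n. F n)"
  have sets_N: "sets ?N = sigma_sets UNIV (\<Union>n. F n)" by (intro sets_measure_of) auto
  have "(\<lambda>z. z) \<in> ?N \<rightarrow>\<^sub>M gen_alg {..0} \<Otimes>\<^sub>M gen_alg {int m..}"
  proof -
    have in_N: "A \<in> sets ?N" if "A \<in> F n" for A n
      unfolding sets_N using that by auto
    have "fst \<in> ?N \<rightarrow>\<^sub>M gen_alg {..0}"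
    proof (rule measurableI)
      fix A :: "(int \<Rightarrow> 'a) set" assume "A \<in> sets (gen_alg {..0})"
      then have "fst -` A \<in> F 0"
        unfolding F_def using measurable_sets[OF measurable_fst, of A "gen_alg {..0}" "gen_alg {..int 0}"]
        by (simp add: space_pair_measure)
      then show "fst -` A \<inter> space ?N \<in> sets ?N" using in_N by (simp add: space_measure_of_conv)
    qed simp
    moreover have "snd \<in> ?N \<rightarrow>\<^sub>M gen_alg {int m..}"
    proof (rule measurable_gen_algI, rule measurableI)
      fix i and B :: "'a set" assume "i \<in> {int m..}" "B \<in> sets borel"
      have "(\<lambda>z. snd z i) \<in> gen_alg {..0} \<Otimes>\<^sub>M gen_alg {..int (nat i)} \<rightarrow>\<^sub>M (borel :: 'a measure)"
        by (rule measurable_compose[OF measurable_snd measurable_coordinate_gen_alg]) auto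
      from measurable_sets[OF this \<open>B \<in> sets borel\<close>]
      have "(\<lambda>z. snd z i) -` B \<in> F (nat i)" by (simp add: F_def space_pair_measure)
      then show "(\<lambda>z. snd z i) -` B \<inter> space ?N \<in> sets ?N"
        using in_N by (simp add: space_measure_of_conv)
    qed simp
    ultimately show ?thesis by (simp add: measurable_pair_iff comp_def)
  qed
  from measurable_sets[OF this S] have S_gen: "S \<in> sigma_sets (space \<mu>) (\<Union>n. F n)"
    by (simp add: sets_N space space_measure_of_conv)
  have "\<exists>n. \<exists>S'\<in>F n. measure \<mu> (sym_diff S S') < e \<and> measure (P \<Otimes>\<^sub>M P) (sym_diff S S') < e"
  proof (rule approx_by_increasing_algebras[OF \<mu>.finite_measure_axioms PP.finite_measure_axioms _ _ _ _ S_gen e])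
    show "algebra (space \<mu>) (F n)" for n
      using sets.algebra_axioms[of "gen_alg {..0} \<Otimes>\<^sub>M gen_alg {..int n} :: ((int \<Rightarrow> 'a) \<times> (int \<Rightarrow> 'a)) measure"]
      by (simp add: F_def space space_pair_measure)
    show "mono F"
      unfolding F_def by (intro monoI sets_pair_gen_alg_mono) auto
  qed (use F_sub in \<open>auto simp: \<mu>_def\<close>)
  then obtain n S' where S': "S' \<in> F n" "measure \<mu> (sym_diff S S') < e" "measure (P \<Otimes>\<^sub>M P) (sym_diff S S') < e"
    by blast
  have "sym_diff S S' \<in> sets (P \<Otimes>\<^sub>M P)" using S' F_sub S both_in_PP by blast
  then have "measure \<mu> (sym_diff S S') = prob {\<omega>. (\<omega>, \<omega>) \<in> sym_diff S S'}"
    unfolding \<mu>_def by (subst measure_distr[OF diag]) (simp_all add: space_P vimage_def)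
  then show thesis using that[of S' n] S' by (simp add: F_def)
qed

lemma delay_P [measurable]: "delay n \<in> P \<rightarrow>\<^sub>M P"
  using delay_measurable[of n] sets_P by (simp cong: measurable_cong_sets)

lemma distr_delay_P: "distr P P (delay n) = P"
proof -
  have "distr P P (delay n) = distr P (paths UNIV) (delay n)"
    by (rule distr_cong) (simp_all add: sets_P)
  also have "\<dots> = P"
    using stationary sets_P by (intro distr_delay) (auto simp: stationary_law_def)
  finally show ?thesis .
qed

lemma prob_delay: "A \<in> sets P \<Longrightarrow> prob (delay n -` A) = prob A"
  using measure_distr[OF delay_P, of A n] by (simp add: distr_delay_P space_P)

definition delay2 :: "nat \<Rightarrow> (int \<Rightarrow> 'a) \<times> (int \<Rightarrow> 'a) \<Rightarrow> (int \<Rightarrow> 'a) \<times> (int \<Rightarrow> 'a)" where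
  "delay2 n z = (delay n (fst z), delay n (snd z))"

lemma PP_delay:
  assumes "A \<in> sets (P \<Otimes>\<^sub>M P)"
  shows "measure (P \<Otimes>\<^sub>M P) (delay2 n -` A) = measure (P \<Otimes>\<^sub>M P) A"
proof -
  have meas: "delay2 n \<in> P \<Otimes>\<^sub>M P \<rightarrow>\<^sub>M P \<Otimes>\<^sub>M P" unfolding delay2_def by measurable
  have "P \<Otimes>\<^sub>M P = distr P P (delay n) \<Otimes>\<^sub>M distr P P (delay n)" by (simp add: distr_delay_P)
  also have "\<dots> = distr (P \<Otimes>\<^sub>M P) (P \<Otimes>\<^sub>M P) (\<lambda>(x, y). (delay n x, delay n y))"
    by (intro pair_measure_distr prob_space_imp_sigma_finite prob_space_distr) measurable
  also have "(\<lambda>(x, y). (delay n x, delay n y)) = delay2 n" by (auto simp: delay2_def)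
  finally have "measure (P \<Otimes>\<^sub>M P) A = measure (distr (P \<Otimes>\<^sub>M P) (P \<Otimes>\<^sub>M P) (delay2 n)) A" by simp
  then show ?thesis
    using measure_distr[OF meas assms] by (simp add: space_pair_measure space_P)
qed

lemma vimage_delay2_gen_alg:
  assumes A: "A \<in> sets (gen_alg I \<Otimes>\<^sub>M gen_alg L)"
    and "\<And>k. k \<in> I \<Longrightarrow> k - int n \<in> I'" "\<And>k. k \<in> L \<Longrightarrow> k - int n \<in> L'"
  shows "delay2 n -` A \<in> sets (gen_alg I' \<Otimes>\<^sub>M gen_alg L')"
proof -
  have [measurable]: "delay n \<in> gen_alg I' \<rightarrow>\<^sub>M (gen_alg I :: (int \<Rightarrow> 'a) measure)"
    "delay n \<in> gen_alg L' \<rightarrow>\<^sub>M (gen_alg L :: (int \<Rightarrow> 'a) measure)"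
    using assms by (auto intro: delay_measurable_gen_alg)
  have "delay2 n \<in> gen_alg I' \<Otimes>\<^sub>M gen_alg L' \<rightarrow>\<^sub>M gen_alg I \<Otimes>\<^sub>M (gen_alg L :: (int \<Rightarrow> 'a) measure)"
    unfolding delay2_def by measurable
  from measurable_sets[OF this A] show ?thesis by (simp add: space_pair_measure)
qed

text \<open>
  The pairs \<open>(\<omega>, \<omega>')\<close> for which \<open>S\<close> notices that the future of \<open>\<omega>\<close> has been replaced by that of an
  independent copy \<open>\<omega>'\<close>.
\<close>
definition mismatch :: "((int \<Rightarrow> 'a) \<times> (int \<Rightarrow> 'a)) set \<Rightarrow> ((int \<Rightarrow> 'a) \<times> (int \<Rightarrow> 'a)) set" where
  "mismatch S = {z. ((fst z, fst z) \<in> S) \<noteq> (z \<in> S)}"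

lemma sets_mismatch:
  assumes "S \<in> sets (P \<Otimes>\<^sub>M P)"
  shows "mismatch S \<in> sets (P \<Otimes>\<^sub>M P)"
proof -
  have "(\<lambda>z. (fst z, fst z)) \<in> P \<Otimes>\<^sub>M P \<rightarrow>\<^sub>M P \<Otimes>\<^sub>M P" by measurable
  from measurable_sets[OF this assms]
  have "{z. (fst z, fst z) \<in> S} \<in> sets (P \<Otimes>\<^sub>M P)" by (simp add: space_pair_measure space_P vimage_def)
  moreover have "mismatch S = sym_diff {z. (fst z, fst z) \<in> S} S" by (auto simp: mismatch_def)
  ultimately show ?thesis using assms by auto
qed

lemma mismatch_delay: "mismatch (delay2 n -` S) = delay2 n -` mismatch S"
  by (auto simp: mismatch_def delay2_def)

lemma mismatch_pos:
  assumes S: "S \<in> sets (P \<Otimes>\<^sub>M P)" and ne: "prob {\<omega>. (\<omega>, \<omega>) \<in> S} \<noteq> measure (P \<Otimes>\<^sub>M P) S"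
  shows "0 < measure (P \<Otimes>\<^sub>M P) (mismatch S)"
proof (rule ccontr)
  assume "\<not> ?thesis"
  then have null: "measure (P \<Otimes>\<^sub>M P) (mismatch S) = 0" by (simp add: zero_less_measure_iff)
  define D where "D = {\<omega>. (\<omega>, \<omega>) \<in> S}"
  have D: "D \<in> sets P" using diagonal_sets[OF S] by (simp add: D_def space_P)
  have vim: "fst -` D \<in> sets (P \<Otimes>\<^sub>M P)"
    using measurable_sets[OF measurable_fst D, of P] by (simp add: space_pair_measure space_P)
  have "prob D = measure (distr (P \<Otimes>\<^sub>M P) P fst) D" by (simp add: distr_pair_fst)
  also have "\<dots> = measure (P \<Otimes>\<^sub>M P) (fst -` D)"
    using D by (subst measure_distr) (simp_all add: space_pair_measure space_P)
  also have "\<dots> = measure (P \<Otimes>\<^sub>M P) S"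
  proof (rule PP.finite_measure_eq_AE)
    have "mismatch S \<in> null_sets (P \<Otimes>\<^sub>M P)"
      using null sets_mismatch[OF S] by (auto simp: null_sets_def PP.emeasure_eq_measure)
    from AE_not_in[OF this] show "AE z in P \<Otimes>\<^sub>M P. z \<in> fst -` D \<longleftrightarrow> z \<in> S"
      by (rule AE_mp) (auto simp: mismatch_def D_def)
  qed (use S vim in auto)
  finally show False using ne by (simp add: D_def)
qed

text \<open>
  The set \<open>T\<close> is \<open>S\<close> with time moved back by \<open>n\<close>, where \<open>n\<close> is the horizon of a set \<open>S'\<close> approximating
  \<open>S\<close>. After the shift, \<open>S'\<close> is an event of the past at time \<open>0\<close>, so that \<open>kernels_separated\<close>
  applies, while \<open>T\<close> still lies in all the \<open>\<sigma>\<close>-fields \<open>both k\<close> because \<open>S\<close> does. By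
  stationarity the shift changes no probability.
\<close>
lemma kernels_nearly_singular:
  assumes S: "\<And>k. S \<in> sets (both k)" and \<delta>: "\<delta> > 0" and c: "0 < c" "c < measure (P \<Otimes>\<^sub>M P) (mismatch S)"
  obtains T where "\<And>k. T \<in> sets (both k)"
    "c \<le> measure (P \<Otimes>\<^sub>M P) {z\<in>space (P \<Otimes>\<^sub>M P). 1 - \<delta> <
        \<bar>measure (\<kappa> (fst z)) (Pair (fst z) -` T) - measure (\<kappa> (snd z)) (Pair (fst z) -` T)\<bar>}"
proof -
  define c' where "c' = measure (P \<Otimes>\<^sub>M P) (mismatch S)"
  \<comment> \<open>Chosen so that the total error \<open>(e + e) * (1 + 1 / \<delta>)\<close> equals \<open>c' - c\<close>.\<close>
  define e where "e = (c' - c) / 2 / (1 + 1 / \<delta>)"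
  have \<delta>': "0 < 1 + 1 / \<delta>" using \<delta> by (simp add: add_pos_pos)
  have e: "e > 0" using c \<delta>' by (simp add: e_def c'_def)
  have SP: "S \<in> sets (P \<Otimes>\<^sub>M P)" using S both_in_PP by blast
  obtain n S' where S': "S' \<in> sets (gen_alg {..0} \<Otimes>\<^sub>M gen_alg {..int n})"
    "prob {\<omega>. (\<omega>, \<omega>) \<in> sym_diff S S'} < e" "measure (P \<Otimes>\<^sub>M P) (sym_diff S S') < e"
    using approx_by_past_sets[OF S e] by blast
  have S'P: "S' \<in> sets (P \<Otimes>\<^sub>M P)"
    using S'(1) sets_pair_measure_mono[of "gen_alg {..0}" P "gen_alg {..int n}" P] gen_alg_in_P
    by (auto simp: space_P)
  define T where "T = delay2 n -` S"
  define T' where "T' = delay2 n -` S'"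
  have T: "T \<in> sets (both k)" for k
    unfolding T_def by (rule vimage_delay2_gen_alg[OF S[of "k + n"]]) auto
  have TF: "T \<in> sets (gen_alg {..0} \<Otimes>\<^sub>M P)"
    using T[of 0] sets_pair_measure_mono[of "gen_alg {..0}" "gen_alg {..0}" "gen_alg {int 0..}" P] gen_alg_in_P
    by (auto simp: space_P)
  have T': "T' \<in> sets (gen_alg {..0} \<Otimes>\<^sub>M gen_alg {..0})"
    unfolding T'_def by (rule vimage_delay2_gen_alg[OF S'(1)]) auto
  have diff: "sym_diff T T' = delay2 n -` sym_diff S S'" by (auto simp: T_def T'_def)
  have J: "prob {\<omega>. (\<omega>, \<omega>) \<in> sym_diff T T'} < e"
  proof -
    have "{\<omega>. (\<omega>, \<omega>) \<in> sym_diff S S'} \<in> sets P"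
      using diagonal_sets[of "sym_diff S S'"] SP S'P by (auto simp: space_P)
    from prob_delay[OF this, of n] show ?thesis using S'(2) by (simp add: diff delay2_def vimage_def)
  qed
  have R: "measure (P \<Otimes>\<^sub>M P) (sym_diff T T') < e"
    unfolding diff using PP_delay[of "sym_diff S S'" n] SP S'P S'(3) by auto
  have "c' = measure (P \<Otimes>\<^sub>M P) (mismatch T)"
    unfolding T_def mismatch_delay c'_def using PP_delay[OF sets_mismatch[OF SP]] by simp
  also have "mismatch T = {z\<in>space (P \<Otimes>\<^sub>M P). ((fst z, fst z) \<in> T) \<noteq> (z \<in> T)}"
    by (simp add: mismatch_def space_pair_measure space_P)
  also have "measure (P \<Otimes>\<^sub>M P) \<dots> \<le> measure (P \<Otimes>\<^sub>M P) {z\<in>space (P \<Otimes>\<^sub>M P). 1 - \<delta> <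
        \<bar>measure (\<kappa> (fst z)) (Pair (fst z) -` T) - measure (\<kappa> (snd z)) (Pair (fst z) -` T)\<bar>}
      + (prob {\<omega>\<in>space P. (\<omega>, \<omega>) \<in> sym_diff T T'} + measure (P \<Otimes>\<^sub>M P) (sym_diff T T')) * (1 + 1 / \<delta>)"
    by (rule kernels_separated[OF TF T' \<delta>])
  finally have dist: "c' \<le> measure (P \<Otimes>\<^sub>M P) {z\<in>space (P \<Otimes>\<^sub>M P). 1 - \<delta> <
        \<bar>measure (\<kappa> (fst z)) (Pair (fst z) -` T) - measure (\<kappa> (snd z)) (Pair (fst z) -` T)\<bar>}
      + (prob {\<omega>\<in>space P. (\<omega>, \<omega>) \<in> sym_diff T T'} + measure (P \<Otimes>\<^sub>M P) (sym_diff T T')) * (1 + 1 / \<delta>)" .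
  have "(prob {\<omega>\<in>space P. (\<omega>, \<omega>) \<in> sym_diff T T'} + measure (P \<Otimes>\<^sub>M P) (sym_diff T T')) * (1 + 1 / \<delta>)
      \<le> (e + e) * (1 + 1 / \<delta>)"
    using J R \<delta>' by (intro mult_right_mono add_mono less_imp_le) (auto simp: space_P)
  also have "\<dots> = 2 * (e * (1 + 1 / \<delta>))" by (simp only: mult_2 distrib_right)
  also have "e * (1 + 1 / \<delta>) = (c' - c) / 2"
    using iffD1[OF nonzero_eq_divide_eq e_def] \<delta>' by simp
  finally have err: "(prob {\<omega>\<in>space P. (\<omega>, \<omega>) \<in> sym_diff T T'} + measure (P \<Otimes>\<^sub>M P) (sym_diff T T')) * (1 + 1 / \<delta>)
      \<le> 2 * ((c' - c) / 2)" .
  have arith: "c \<le> x" if "c' \<le> x + y" "y \<le> 2 * ((c' - c) / 2)" for x y using that by simp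
  show thesis by (rule that[OF T arith[OF dist err]])
qed

text \<open>
  The events \<open>H j\<close> that \<open>\<kappa> \<omega>\<close> and \<open>\<kappa> \<omega>'\<close> are singular up to \<open>1 / (j + 1)\<close> on the future after \<open>j\<close> all
  have probability at least \<open>c\<close>, hence so does their upper limit, on which exact singularity holds.
  Expressing \<open>H j\<close> by a countable family of future events makes it measurable.
\<close>
lemma singular_pairs_of_tail_set:
  assumes S: "\<And>k. S \<in> sets (both k)" and ne: "prob {\<omega>. (\<omega>, \<omega>) \<in> S} \<noteq> measure (P \<Otimes>\<^sub>M P) S"
  obtains H where "H \<in> sets (P \<Otimes>\<^sub>M P)" "0 < measure (P \<Otimes>\<^sub>M P) H"
    "\<And>z k. z \<in> H \<Longrightarrow> mutually_singular_on (sets (gen_alg {int k..})) (\<kappa> (fst z)) (\<kappa> (snd z))"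
proof -
  have "S \<in> sets (P \<Otimes>\<^sub>M P)" using S both_in_PP by blast
  from mismatch_pos[OF this ne] obtain c where c: "0 < c" "c < measure (P \<Otimes>\<^sub>M P) (mismatch S)"
    using dense by blast
  have "\<exists>C :: nat \<Rightarrow> (int \<Rightarrow> 'a) set. (\<forall>i. C i \<in> sets (gen_alg {int j..})) \<and>
      (\<forall>\<mu> \<nu> A e. finite_measure \<mu> \<longrightarrow> finite_measure \<nu> \<longrightarrow> sets \<mu> = sets (paths UNIV) \<longrightarrow>
        sets \<nu> = sets (paths UNIV) \<longrightarrow> A \<in> sets (gen_alg {int j..}) \<longrightarrow> (e::real) > 0 \<longrightarrow>
        (\<exists>i. measure \<mu> A - measure \<nu> A - e < measure \<mu> (C i) - measure \<nu> (C i)))" for j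
    by (rule countable_family_almost_maximal_future[of "int j"]) blast
  then obtain C :: "nat \<Rightarrow> nat \<Rightarrow> (int \<Rightarrow> 'a) set" where C: "\<And>j i. C j i \<in> sets (gen_alg {int j..})"
    and C_max: "\<And>j \<mu> \<nu> A e. \<lbrakk>finite_measure \<mu>; finite_measure \<nu>; sets \<mu> = sets (paths UNIV);
        sets \<nu> = sets (paths UNIV); A \<in> sets (gen_alg {int j..}); (e::real) > 0\<rbrakk>
        \<Longrightarrow> \<exists>i. measure \<mu> A - measure \<nu> A - e < measure \<mu> (C j i) - measure \<nu> (C j i)"
    by metis
  define H where "H j = {z\<in>space (P \<Otimes>\<^sub>M P). \<exists>i. 1 - inverse (Suc j) <
      measure (\<kappa> (fst z)) (C j i) - measure (\<kappa> (snd z)) (C j i)}" for j :: nat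
  have C_P: "C j i \<in> sets P" for i j using C gen_alg_in_P by blast
  have [measurable]: "(\<lambda>\<omega>. measure (\<kappa> \<omega>) (C j i)) \<in> borel_measurable P" for i j
    using measurable_compose[OF kernel_P measurable_measure_prob_algebra[OF C_P]] .
  have H_sets: "H j \<in> sets (P \<Otimes>\<^sub>M P)" for j unfolding H_def by measurable
  have H_large: "c \<le> measure (P \<Otimes>\<^sub>M P) (H j)" for j
  proof -
    obtain T where T: "\<And>k. T \<in> sets (both k)"
      "c \<le> measure (P \<Otimes>\<^sub>M P) {z\<in>space (P \<Otimes>\<^sub>M P). 1 - inverse (Suc j) <
        \<bar>measure (\<kappa> (fst z)) (Pair (fst z) -` T) - measure (\<kappa> (snd z)) (Pair (fst z) -` T)\<bar>}"
      using kernels_nearly_singular[OF S _ c, of "inverse (Suc j)"] by auto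
    have "{z\<in>space (P \<Otimes>\<^sub>M P). 1 - inverse (Suc j) <
        \<bar>measure (\<kappa> (fst z)) (Pair (fst z) -` T) - measure (\<kappa> (snd z)) (Pair (fst z) -` T)\<bar>} \<subseteq> H j"
    proof safe
      fix x y assume xy: "(x, y) \<in> space (P \<Otimes>\<^sub>M P)" and far: "1 - inverse (Suc j) <
        \<bar>measure (\<kappa> (fst (x, y))) (Pair (fst (x, y)) -` T) - measure (\<kappa> (snd (x, y))) (Pair (fst (x, y)) -` T)\<bar>"
      define A where "A = Pair x -` T"
      have A: "A \<in> sets (gen_alg {int j..})" "UNIV - A \<in> sets (gen_alg {int j..})"
        unfolding A_def using sets_Pair1[OF T(1)[of j]] sets.compl_sets[OF sets_Pair1[OF T(1)[of j]]] by auto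
      have AP: "A \<in> sets (\<kappa> x)" using A gen_alg_in_P \<kappa>_prob(2) by blast
      \<comment> \<open>The fibre or its complement, according to the sign of the difference.\<close>
      obtain A' where A': "A' \<in> sets (gen_alg {int j..})"
        "1 - inverse (Suc j) < measure (\<kappa> x) A' - measure (\<kappa> y) A'"
        using measure_diff_le_abs[OF \<kappa>_prob(1) \<kappa>_prob(1) _ AP, of y "1 - inverse (Suc j)"] far A
        by (force simp: \<kappa>_prob A_def)
      have "\<exists>i. measure (\<kappa> x) A' - measure (\<kappa> y) A' - (measure (\<kappa> x) A' - measure (\<kappa> y) A' - (1 - inverse (Suc j)))
          < measure (\<kappa> x) (C j i) - measure (\<kappa> y) (C j i)"
        using A' by (intro C_max) (auto simp: \<kappa>_prob sets_P intro: prob_space.axioms(1))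
      then show "(x, y) \<in> H j" using xy by (simp add: H_def)
    qed
    from PP.finite_measure_mono[OF this H_sets] T(2) show ?thesis by linarith
  qed
  define W where "W n = (\<Union>j\<in>{n..}. H j)" for n
  have W: "W n \<in> sets (P \<Otimes>\<^sub>M P)" for n unfolding W_def using H_sets by auto
  have "decseq W" by (force simp: W_def decseq_def)
  then have "(\<lambda>n. measure (P \<Otimes>\<^sub>M P) (W n)) \<longlonglongrightarrow> measure (P \<Otimes>\<^sub>M P) (\<Inter>n. W n)"
    using W by (intro PP.finite_Lim_measure_decseq) auto
  moreover have "c \<le> measure (P \<Otimes>\<^sub>M P) (W n)" for n
    using H_large[of n] PP.finite_measure_mono[of "H n" "W n"] W by (force simp: W_def)
  ultimately have "c \<le> measure (P \<Otimes>\<^sub>M P) (\<Inter>n. W n)" by (intro LIMSEQ_le_const) auto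
  moreover have "mutually_singular_on (sets (gen_alg {int k..})) (\<kappa> (fst z)) (\<kappa> (snd z))"
    if z: "z \<in> (\<Inter>n. W n)" for z k
  proof (rule singular_of_sup_eq_1)
    show "sigma_algebra (space (\<kappa> (fst z))) (sets (gen_alg {int k..}))"
      using sets.sigma_algebra_axioms[of "gen_alg {int k..}"] by (simp add: \<kappa>_prob)
    fix e :: real assume "e > 0"
    then obtain m where m: "inverse (Suc m) < e" using reals_Archimedean by blast
    from z have "z \<in> W (max k m)" by blast
    then obtain j where j: "k \<le> j" "m \<le> j" "z \<in> H j" by (auto simp: W_def)
    then obtain i where i: "1 - inverse (Suc j) < measure (\<kappa> (fst z)) (C j i) - measure (\<kappa> (snd z)) (C j i)"
      by (auto simp: H_def)
    have "inverse (real (Suc j)) \<le> inverse (real (Suc m))" using j(2) by (intro le_imp_inverse_le) auto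
    moreover have "C j i \<in> sets (gen_alg {int k..})"
      using C[of j i] gen_alg_mono[of "{int j..}" "{int k..}"] j(1) by auto
    moreover from calculation have "1 - e < measure (\<kappa> (fst z)) (C j i) - measure (\<kappa> (snd z)) (C j i)"
      using i m by linarith
    ultimately show "\<exists>S\<in>sets (gen_alg {int k..}). 1 - e < measure (\<kappa> (fst z)) S - measure (\<kappa> (snd z)) S"
      by blast
  qed (use gen_alg_in_P in \<open>auto simp: \<kappa>_prob\<close>)
  ultimately show thesis using that[of "\<Inter>n. W n"] W c(1) by auto
qed

lemma regular_of_nonsingular:
  assumes "AE (x, x') in law_on P {..0} \<Otimes>\<^sub>M law_on P {..0}.
    \<exists>k::nat. \<not> mutually_singular_on (sets (gen_alg {int k..})) (K x) (K x')"
  shows "absolutely_regular P"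
proof (rule ccontr)
  assume "\<not> absolutely_regular P"
  then obtain S where S: "\<And>k. S \<in> sets (both k)" "prob {\<omega>. (\<omega>, \<omega>) \<in> S} \<noteq> measure (P \<Otimes>\<^sub>M P) S"
    using tail_set_of_not_regular by blast
  obtain H where H: "H \<in> sets (P \<Otimes>\<^sub>M P)" "0 < measure (P \<Otimes>\<^sub>M P) H"
    "\<And>z k. z \<in> H \<Longrightarrow> mutually_singular_on (sets (gen_alg {int k..})) (\<kappa> (fst z)) (\<kappa> (snd z))"
    using singular_pairs_of_tail_set[OF S] by blast
  have law: "law_on P {..0} \<Otimes>\<^sub>M law_on P {..0}
      = distr (P \<Otimes>\<^sub>M P) (paths {..0} \<Otimes>\<^sub>M paths {..0}) (\<lambda>(x, y). (coord {..0} x, coord {..0} y))"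
    unfolding law_on_def
    by (intro pair_measure_distr prob_space_imp_sigma_finite prob_space_distr) measurable
  from assms have "AE z in distr (P \<Otimes>\<^sub>M P) (paths {..0} \<Otimes>\<^sub>M paths {..0}) (\<lambda>(x, y). (coord {..0} x, coord {..0} y)).
      \<exists>k::nat. \<not> mutually_singular_on (sets (gen_alg {int k..})) (K (fst z)) (K (snd z))"
    unfolding law by (simp only: split_beta')
  then have "AE z in P \<Otimes>\<^sub>M P. \<exists>k::nat.
      \<not> mutually_singular_on (sets (gen_alg {int k..})) (\<kappa> (fst z)) (\<kappa> (snd z))"
    by (drule_tac AE_distrD[rotated]) (auto simp: \<kappa>_def case_prod_beta)
  then have "AE z in P \<Otimes>\<^sub>M P. z \<notin> H" by (rule AE_mp) (use H(3) in auto)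
  then have "measure (P \<Otimes>\<^sub>M P) H = 0"
    using H(1) AE_iff_null_sets[OF H(1)] by (auto simp: null_sets_def measure_def)
  with H(2) show False by simp
qed

section \<open>Regularity implies convergence, and convergence implies non-singularity\<close>

lemma nonsingular_of_conditional_convergence:
  assumes "AE x in law_on P {..0}. (\<lambda>k::nat. tv_norm_on (sets (gen_alg {int k..})) (K x) P) \<longlonglongrightarrow> 0"
  shows "AE (x, x') in law_on P {..0} \<Otimes>\<^sub>M law_on P {..0}.
    \<exists>k::nat. \<not> mutually_singular_on (sets (gen_alg {int k..})) (K x) (K x')"
proof -
  let ?L = "law_on P {..0}"
  interpret L: prob_space ?L by (rule prob_law)
  interpret LL: pair_prob_space ?L ?L ..
  let ?conv = "\<lambda>x. (\<lambda>k::nat. tv_norm_on (sets (gen_alg {int k..})) (K x) P) \<longlonglongrightarrow> 0"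
  have "AE z in ?L \<Otimes>\<^sub>M ?L. ?conv (fst z)"
  proof (rule AE_distrD[OF measurable_fst])
    show "AE x in distr (?L \<Otimes>\<^sub>M ?L) ?L fst. ?conv x" unfolding L.distr_pair_fst by (rule assms)
  qed
  moreover from this have "AE z in ?L \<Otimes>\<^sub>M ?L. ?conv (snd z)"
  proof (subst (asm) LL.distr_pair_swap)
    assume "AE z in distr (?L \<Otimes>\<^sub>M ?L) (?L \<Otimes>\<^sub>M ?L) (\<lambda>(x, y). (y, x)). ?conv (fst z)"
    from AE_distrD[OF measurable_pair_swap' this] show ?thesis by (simp add: case_prod_beta)
  qed
  moreover have "AE z in ?L \<Otimes>\<^sub>M ?L. fst z \<in> space ?L \<and> snd z \<in> space ?L"
    by (rule AE_I2) (auto simp: space_pair_measure)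
  ultimately show ?thesis
  proof eventually_elim
    fix z assume conv: "?conv (fst z)" "?conv (snd z)" and z: "fst z \<in> space ?L \<and> snd z \<in> space ?L"
    \<comment> \<open>The norm carries a factor \<open>2\<close>: below \<open>1\<close>, probabilities differ from \<open>P\<close> by less than \<open>1/2\<close>.\<close>
    then have "\<forall>\<^sub>F k in sequentially. tv_norm_on (sets (gen_alg {int k..})) (K (fst z)) P < 1
        \<and> tv_norm_on (sets (gen_alg {int k..})) (K (snd z)) P < 1"
      by (intro eventually_conj order_tendstoD(2)[of _ 0]) auto
    then obtain k :: nat where k: "tv_norm_on (sets (gen_alg {int k..})) (K (fst z)) P < 1"
      "tv_norm_on (sets (gen_alg {int k..})) (K (snd z)) P < 1"
      by (auto simp: eventually_sequentially)
    have K: "prob_space (K (fst z))" "prob_space (K (snd z))" "space (K (snd z)) = UNIV" "sets (K (snd z)) = sets P"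
      using z by (auto intro!: K_prob simp: law_on_def)
    interpret K1: prob_space "K (fst z)" by (rule K(1))
    interpret K2: prob_space "K (snd z)" by (rule K(2))
    have "\<not> mutually_singular_on (sets (gen_alg {int k..})) (K (fst z)) (K (snd z))"
    proof
      assume "mutually_singular_on (sets (gen_alg {int k..})) (K (fst z)) (K (snd z))"
      then obtain A where A: "A \<in> sets (gen_alg {int k..})" "emeasure (K (fst z)) A = 0"
        "emeasure (K (snd z)) (UNIV - A) = 0"
        unfolding mutually_singular_on_def K(3) by blast
      have "A \<in> sets (K (snd z))" using A(1) gen_alg_in_P K(4) by blast
      then have "measure (K (snd z)) A = 1" "measure (K (fst z)) A = 0"
        using A(2,3) K2.prob_compl[of A] by (simp_all add: K(3) measure_def)
      then have "2 * \<bar>1 - prob A\<bar> < 1" "2 * \<bar>0 - prob A\<bar> < 1"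
        using tv_norm_on_upper[OF K(2) prob_P A(1)] tv_norm_on_upper[OF K(1) prob_P A(1)] k
        by simp_all
      then show False by (simp add: abs_real_def split: if_split_asm)
    qed
    then show "case z of (x, x') \<Rightarrow> \<exists>k::nat. \<not> mutually_singular_on (sets (gen_alg {int k..})) (K x) (K x')"
      by (auto simp: case_prod_beta)
  qed
qed

text \<open>
  The exceptional set \<open>E\<close> consists of the pasts \<open>x\<close> for which some event \<open>C i\<close> of a countable family has
  \<open>K x (C i) - P (C i) > e\<close>. Taking the first such \<open>i\<close> as the fibre over \<open>x\<close> defines a set on
  which the joint law exceeds the product law by at least \<open>e\<close> times the probability of \<open>E\<close>.
\<close>
lemma past_prob_large_conditional_difference:
  obtains E where "E \<in> sets (paths {..0})"
    "e * measure (law_on P {..0}) E \<le> tv_norm (joint k) (product k) / 2"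
    "\<And>x. x \<in> space (paths {..0}) - E \<Longrightarrow> \<forall>A\<in>sets (gen_alg {int k..}). \<bar>measure (K x) A - prob A\<bar> \<le> e"
proof -
  let ?L = "law_on P {..0}"
  obtain C :: "nat \<Rightarrow> (int \<Rightarrow> 'a) set" where C: "\<And>i. C i \<in> sets (gen_alg {int k..})"
    and C_max: "\<And>\<mu> \<nu> A e. \<lbrakk>finite_measure \<mu>; finite_measure \<nu>; sets \<mu> = sets (paths UNIV);
      sets \<nu> = sets (paths UNIV); A \<in> sets (gen_alg {int k..}); (e::real) > 0\<rbrakk>
      \<Longrightarrow> \<exists>i. measure \<mu> A - measure \<nu> A - e < measure \<mu> (C i) - measure \<nu> (C i)"
    using countable_family_almost_maximal_future[of "int k"] by blast
  have C_P: "C i \<in> sets P" for i using C gen_alg_in_P by blast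
  have "\<exists>A. A \<in> sets (paths {int k..}) \<and> C i = coord {int k..} -` A" for i
    using C[of i] unfolding sets_gen_alg by blast
  then obtain A where A: "\<And>i. A i \<in> sets (paths {int k..})" "\<And>i. C i = coord {int k..} -` A i" by metis
  define E where "E i = {x\<in>space (paths {..0}). e < measure (K x) (C i) - prob (C i)}" for i
  have [measurable]: "(\<lambda>x. measure (K x) (C i)) \<in> borel_measurable (paths {..0})" for i
    using measurable_compose[OF K_measurable measurable_measure_prob_algebra[of "C i"]] C_P sets_P by blast
  have E: "E i \<in> sets (paths {..0})" for i unfolding E_def by measurable
  \<comment> \<open>\<open>B i\<close> contains the pasts for which \<open>i\<close> is the first index that works.\<close>
  define B where "B i = disjointed E i" for i
  have B: "B i \<in> sets (paths {..0})" for i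
  proof -
    have "range (disjointed E) \<subseteq> sets (paths {..0})"
      using E by (intro sets.range_disjointed_sets) auto
    then show ?thesis unfolding B_def by blast
  qed
  have B_E: "B i \<subseteq> E i" for i unfolding B_def by (rule disjointed_subset)
  have B_disj: "disjoint_family B" unfolding B_def by (rule disjoint_family_disjointed)
  have UN_B: "(\<Union>i. B i) = (\<Union>i. E i)" unfolding B_def by (rule UN_disjointed_eq)
  define S where "S = (\<Union>i. B i \<times> A i)"
  have BA: "B i \<times> A i \<in> sets (paths {..0} \<Otimes>\<^sub>M paths {int k..})" for i using B A(1) by simp
  have BA_disj: "disjoint_family (\<lambda>i. B i \<times> A i)" using B_disj by (auto simp: disjoint_family_on_def)
  have S: "S \<in> sets (paths {..0} \<Otimes>\<^sub>M paths {int k..})" unfolding S_def using BA by auto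
  interpret joint: prob_space "joint k" by (rule prob_joint)
  interpret product: prob_space "product k" by (rule prob_product)
  interpret L: prob_space ?L by (rule prob_law)
  interpret Lk: prob_space "law_on P {int k..}" by (rule prob_law)
  have sums_joint: "(\<lambda>i. measure (joint k) (B i \<times> A i)) sums measure (joint k) S"
    unfolding S_def using BA by (intro joint.finite_measure_UNION BA_disj) auto
  have sums_product: "(\<lambda>i. measure (product k) (B i \<times> A i)) sums measure (product k) S"
    unfolding S_def using BA BA_disj
    by (intro product.finite_measure_UNION) (auto simp: law_on_def cong: sets_pair_measure_cong)
  have sums_law: "(\<lambda>i. e * measure ?L (B i)) sums (e * measure ?L (\<Union>i. B i))"
    using B B_disj by (intro sums_mult L.finite_measure_UNION) (auto simp: law_on_def)
  have rectangle: "e * measure ?L (B i) \<le> measure (joint k) (B i \<times> A i) - measure (product k) (B i \<times> A i)" for i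
  proof -
    define D where "D = coord {..0} -` B i"
    have D: "D \<in> sets (gen_alg {..0})" unfolding D_def sets_gen_alg using B by blast
    have DP: "D \<in> sets P" using D gen_alg_in_P by blast
    have law_B: "measure ?L (B i) = prob D"
      unfolding law_on_def D_def using B by (subst measure_distr) (auto simp: space_P)
    have law_A: "measure (law_on P {int k..}) (A i) = prob (C i)"
      unfolding law_on_def A(2) using A(1) by (subst measure_distr) (auto simp: space_P)
    have "measure (product k) (B i \<times> A i) = prob D * prob (C i)"
      using B A(1) unfolding law_A[symmetric] law_B[symmetric]
      by (subst measure_def, subst Lk.emeasure_pair_measure_Times)
        (auto simp: law_on_def enn2real_mult measure_def)
    moreover have "measure (joint k) (B i \<times> A i) = prob (D \<inter> C i)"
      unfolding measure_joint[OF BA] by (rule arg_cong[where f=prob]) (auto simp: D_def A(2))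
    moreover have "(e + prob (C i)) * prob D \<le> prob (D \<inter> C i)"
    proof -
      have \<kappa>C: "(\<lambda>\<omega>. measure (\<kappa> \<omega>) (C i)) \<in> borel_measurable P"
        using measurable_compose[OF kernel_P measurable_measure_prob_algebra[OF C_P]] .
      have "(e + prob (C i)) * prob D = (\<integral>\<omega>\<in>D. (e + prob (C i)) \<partial>P)"
        using DP by (simp add: set_integral_const emeasure_eq_measure mult.commute)
      also have "\<dots> \<le> (\<integral>\<omega>\<in>D. measure (\<kappa> \<omega>) (C i) \<partial>P)"
      proof (rule set_integral_mono)
        show "set_integrable P D (\<lambda>\<omega>. e + prob (C i))"
          using DP by (simp add: set_integrable_def emeasure_eq_measure)
        have "integrable P (\<lambda>\<omega>. measure (\<kappa> \<omega>) (C i))"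
          using \<kappa>C by (intro integrable_const_bound[of _ 1]) (auto simp: prob_space.prob_le_1[OF \<kappa>_prob(1)])
        then show "set_integrable P D (\<lambda>\<omega>. measure (\<kappa> \<omega>) (C i))"
          unfolding set_integrable_def by (rule integrable_mult_indicator[OF DP])
        fix \<omega> assume "\<omega> \<in> D"
        then have "coord {..0} \<omega> \<in> E i" using B_E by (auto simp: D_def)
        then show "e + prob (C i) \<le> measure (\<kappa> \<omega>) (C i)" by (simp add: E_def \<kappa>_def)
      qed
      also have "\<dots> = prob (D \<inter> C i)" by (rule integral_\<kappa>[OF C_P D])
      finally show ?thesis .
    qed
    ultimately show ?thesis by (simp add: law_B algebra_simps)
  qed
  have "e * measure ?L (\<Union>i. B i) \<le> measure (joint k) S - measure (product k) S"
    by (rule sums_le[OF rectangle sums_law sums_diff[OF sums_joint sums_product]])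
  also have "\<dots> \<le> tv_norm (joint k) (product k) / 2"
    unfolding tv_norm_def
    using tv_norm_on_upper[OF prob_joint prob_product, of S "sets (joint k)" k k] S
      abs_ge_self[of "measure (joint k) S - measure (product k) S"] by simp
  finally have bound: "e * measure ?L (\<Union>i. E i) \<le> tv_norm (joint k) (product k) / 2"
    unfolding UN_B .
  show thesis
  proof
    show "(\<Union>i. E i) \<in> sets (paths {..0})" using E by auto
    show "e * measure ?L (\<Union>i. E i) \<le> tv_norm (joint k) (product k) / 2" by (rule bound)
  next
    fix x assume x: "x \<in> space (paths {..0}) - (\<Union>i. E i)"
    note Kx = K_prob[of x]
    have le: "measure (K x) A - prob A \<le> e" if "A \<in> sets (gen_alg {int k..})" for A
    proof (rule ccontr)
      assume "\<not> ?thesis"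
      then have "\<exists>i. measure (K x) A - prob A - (measure (K x) A - prob A - e) < measure (K x) (C i) - prob (C i)"
        using x Kx that by (intro C_max) (auto simp: sets_P finite_measure_axioms prob_space.axioms(1))
      then show False using x by (auto simp: E_def)
    qed
    show "\<forall>A\<in>sets (gen_alg {int k..}). \<bar>measure (K x) A - prob A\<bar> \<le> e"
    proof
      fix A :: "(int \<Rightarrow> 'a) set" assume A: "A \<in> sets (gen_alg {int k..})"
      have "UNIV - A \<in> sets (gen_alg {int k..})" using sets.compl_sets[OF A] by simp
      moreover have "A \<in> sets (K x)" using A gen_alg_in_P x Kx(2) by blast
      ultimately show "\<bar>measure (K x) A - prob A\<bar> \<le> e"
        using x Kx le A by (intro measure_diff_le_abs[OF _ prob_P]) auto
    qed
  qed
qed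

lemma conditional_convergence_of_regular:
  assumes "absolutely_regular P"
  shows "AE x in law_on P {..0}. (\<lambda>k::nat. tv_norm_on (sets (gen_alg {int k..})) (K x) P) \<longlonglongrightarrow> 0"
proof -
  let ?L = "law_on P {..0}"
  interpret L: prob_space ?L by (rule prob_law)
  have space_L: "space ?L = space (paths {..0})" and sets_L: "sets ?L = sets (paths {..0})"
    by (simp_all add: law_on_def)
  have lim: "(\<lambda>k. tv_norm (joint k) (product k)) \<longlonglongrightarrow> 0"
    using assms by (simp add: absolutely_regular_def)
  have "AE x in ?L. \<exists>k::nat. \<forall>A\<in>sets (gen_alg {int k..}). \<bar>measure (K x) A - prob A\<bar> \<le> e" if e: "e > 0" for e
  proof -
    let ?good = "\<lambda>k E. E \<in> sets (paths {..0}) \<and> e * measure ?L E \<le> tv_norm (joint k) (product k) / 2 \<and>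
      (\<forall>x\<in>space (paths {..0}) - E. \<forall>A\<in>sets (gen_alg {int k..}). \<bar>measure (K x) A - prob A\<bar> \<le> e)"
    have ex: "\<exists>E. ?good k E" for k by (rule past_prob_large_conditional_difference[of e k]) blast
    define E where "E k = (SOME E. ?good k E)" for k
    have "?good k (E k)" for k unfolding E_def by (rule someI_ex[OF ex])
    then have E: "E k \<in> sets (paths {..0})"
      "e * measure ?L (E k) \<le> tv_norm (joint k) (product k) / 2"
      "x \<in> space (paths {..0}) - E k \<Longrightarrow> \<forall>A\<in>sets (gen_alg {int k..}). \<bar>measure (K x) A - prob A\<bar> \<le> e"
      for k x by blast+
    have "e * measure ?L (\<Inter>k. E k) \<le> tv_norm (joint k) (product k) / 2" for k
    proof -
      have "measure ?L (\<Inter>k. E k) \<le> measure ?L (E k)"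
        using E(1) by (intro L.finite_measure_mono) (auto simp: sets_L)
      then show ?thesis using E(2)[of k] e by (meson mult_left_mono less_imp_le order_trans)
    qed
    then have "e * measure ?L (\<Inter>k. E k) \<le> 0 / 2"
      by (intro LIMSEQ_le_const[OF tendsto_divide[OF lim tendsto_const]]) auto
    then have "measure ?L (\<Inter>k. E k) = 0"
      using e by (simp add: mult_le_0_iff measure_le_0_iff)
    then have "(\<Inter>k. E k) \<in> null_sets ?L"
      using E(1) by (auto simp: null_sets_def L.emeasure_eq_measure sets_L)
    from AE_not_in[OF this] AE_space show ?thesis
    proof eventually_elim
      fix x assume "x \<notin> (\<Inter>k. E k)" "x \<in> space ?L"
      then obtain k where "x \<in> space (paths {..0}) - E k" by (auto simp: space_L)
      from E(3)[OF this] show "\<exists>k::nat. \<forall>A\<in>sets (gen_alg {int k..}). \<bar>measure (K x) A - prob A\<bar> \<le> e" by blast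
    qed
  qed
  then have "AE x in ?L. \<forall>m. \<exists>k::nat. \<forall>A\<in>sets (gen_alg {int k..}).
      \<bar>measure (K x) A - prob A\<bar> \<le> inverse (Suc m)"
    by (subst AE_all_countable) (auto simp del: of_nat_Suc)
  then show ?thesis using AE_space
  proof eventually_elim
    fix x assume close: "\<forall>m. \<exists>k::nat. \<forall>A\<in>sets (gen_alg {int k..}). \<bar>measure (K x) A - prob A\<bar> \<le> inverse (Suc m)"
      and x: "x \<in> space ?L"
    show "(\<lambda>k::nat. tv_norm_on (sets (gen_alg {int k..})) (K x) P) \<longlonglongrightarrow> 0"
    proof (rule LIMSEQ_I)
      fix r :: real assume "r > 0"
      then obtain m where m: "inverse (Suc m) < r / 2" using reals_Archimedean[of "r/2"] by auto
      from close obtain k :: nat where k: "\<forall>A\<in>sets (gen_alg {int k..}). \<bar>measure (K x) A - prob A\<bar> \<le> inverse (Suc m)"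
        by blast
      have "norm (tv_norm_on (sets (gen_alg {int n..})) (K x) P - 0) < r" if "k \<le> n" for n
      proof -
        have "tv_norm_on (sets (gen_alg {int n..})) (K x) P \<le> 2 * inverse (Suc m)"
          using k gen_alg_mono[of "{int n..}" "{int k..}"] that by (intro tv_norm_on_least) auto
        moreover have "0 \<le> tv_norm_on (sets (gen_alg {int n..})) (K x) P"
          using x by (intro tv_norm_on_nonneg K_prob prob_P) (auto simp: space_L)
        ultimately show ?thesis using m by simp
      qed
      then show "\<exists>k. \<forall>n\<ge>k. norm (tv_norm_on (sets (gen_alg {int n..})) (K x) P - 0) < r" by blast
    qed
  qed
qed

end

theorem corollary2p8:
  fixes P :: "(int \<Rightarrow> 'a::polish_space) measure"
    and K :: "(int \<Rightarrow> 'a) \<Rightarrow> (int \<Rightarrow> 'a) measure"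
  assumes "stationary_law P"
    and "reg_cond_prob_past P K"
  shows "(absolutely_regular P \<longleftrightarrow>
          (AE x in law_on P {..0}.
             (\<lambda>k::nat. tv_norm_on (sets (gen_alg {int k..})) (K x) P) \<longlonglongrightarrow> 0))
       \<and> (absolutely_regular P \<longleftrightarrow>
          (AE (x, x') in law_on P {..0} \<Otimes>\<^sub>M law_on P {..0}.
             \<exists>k::nat. \<not> mutually_singular_on (sets (gen_alg {int k..})) (K x) (K x')))"
proof -
  interpret stationary_past P K using assms by unfold_locales
  show ?thesis
    using conditional_convergence_of_regular nonsingular_of_conditional_convergence regular_of_nonsingular
    by blast
qed

end
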